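(* Let $n\ge 1$ and $w\in\mathcal S_n$, and let $G_w=\sum_{\delta\in GPDs(w)} wt(\delta)\in\mathbb Z[x_1,\dots,x_n,y_1,\dots,y_n,A,B]$ be the generic pipe dream polynomial of $w$ (defined in the context). (1) The highest power of $B$ occurring in $G_w$ is $B^{n^2-\ell(w)}$. The generic pipe dreams $\delta\in GPDs(w)$ whose weight $wt(\delta)$ contributes to this $B$-leading form are exactly the classic pipe dreams, i.e. those in which (i) every cell $(i,j)$ with $i+j>n+1$ is blank and (ii) no two pipes cross each other twice. The $B$-leading form of $G_w$ equals $$B^{\,n^2-\ell(w)}\; S_w(A+x_1,\dots,A+x_n,\;y_1,\dots,y_n).$$ (2) The highest power of $A$ occurring in $G_w$ is $A^{n^2-\ell(w)}$. The generic pipe dreams contributing to this $A$-leading form are exactly those with (i) no bump tiles and (ii) no two pipes crossing twice. The $A$-leading form of $G_w$ equals $$A^{\,n^2-\ell(w)}\; S_{w_0ww_0}(B-x_n,\dots,B-x_1,\;-y_n,\dots,-y_1).$$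
   Context: $[n]=\{1,\dots,n\}$; $\ell(w)$ is the Coxeter length (number of inversions) of $w$; $w_0=n\,n{-}1\cdots 2\,1$ is the longest element of $\mathcal S_n$. $S_u(x_1,\dots,x_n,y_1,\dots,y_n)$ denotes the Lascoux–Schützenberger double Schubert polynomial of $u\in\mathcal S_n$, normalized by $S_{w_0}=\prod_{i+j\le n}(x_i-y_j)$ and obtained from it by divided differences in the $x$ variables (so that e.g. $S_{2431}=(x_1-y_1)(x_2-y_1)(x_3-y_1)(x_1+x_2-y_2-y_3)$). Generic pipe dream tiles: each tile is a unit square containing some arcs ("pipes") joining midpoints of its sides, of one of seven kinds: bump (two pipes, one joining West to North, one joining South to East); cross (two pipes, West–East and South–North, crossing); elbow "j" (one pipe joining West to North); elbow "r" (one pipe joining South to East); horizontal (one pipe West–East); vertical (one pipe South–North); blank (no pipe). A generic pipe dream (GPD) for $w$ is a filling of the cells $(i,j)$, $i,j\in[n]$ (row $i$ counted from the top, column $j$ from the left) of an $n\times n$ grid by such tiles, such that adjacent tiles agree (a pipe meets a shared edge from one side iff from the other), every West and every North boundary edge is met by a pipe, no South or East boundary edge is, and, following pipes (which move only right and up, going straight through crosses), the pipe entering at the West edge of row $i$ (labelled $i$) leaves through the North edge of column $w(i)$; equivalently the North boundary labels read $w^{-1}(1),\dots,w^{-1}(n)$ from left to right. Two pipes may cross more than once. $GPDs(w)$ is the set of these. The weight is $wt(\delta)=\prod_{i,j\in[n]} f_{ij}$ where $f_{ij}=A+x_i-y_j$ if the tile at $(i,j)$ is a cross, vertical or horizontal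 tile, $f_{ij}=B-x_i+y_j$ if it is blank, and $f_{ij}=A+B$ otherwise (bump or elbow). The $B$-leading form is the sum of the terms of $G_w$ of highest degree in $B$ (similarly for $A$). *)

theory Defs
  imports Complex_Main "HOL-Library.Poly_Mapping" "HOL-Library.FuncSet"
    "HOL-Combinatorics.Permutations"
begin

section \<open>Polynomials\<close>

text \<open>
  The polynomial ring over the integers in the variables $x_i$, $y_j$, $A$, $B$.  For every $n$ it
  contains the ring on the variables with indices $1,\dots,n$; variables with other indices exist
  in the type but do not occur in the polynomials considered below.
\<close>

datatype var = X_var nat | Y_var nat | A_var | B_var

type_synonym mono = "var \<Rightarrow>\<^sub>0 nat"
type_synonym pol = "mono \<Rightarrow>\<^sub>0 int"

definition pvar :: "var \<Rightarrow> pol" where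
  "pvar v = Poly_Mapping.single (Poly_Mapping.single v 1) 1"

abbreviation pX :: "nat \<Rightarrow> pol" where "pX i \<equiv> pvar (X_var i)"
abbreviation pY :: "nat \<Rightarrow> pol" where "pY j \<equiv> pvar (Y_var j)"
abbreviation pA :: pol where "pA \<equiv> pvar A_var"
abbreviation pB :: pol where "pB \<equiv> pvar B_var"

text \<open>Simultaneous substitution of \<open>\<sigma> v\<close> for every variable \<open>v\<close>.\<close>

definition subst :: "(var \<Rightarrow> pol) \<Rightarrow> pol \<Rightarrow> pol" where
  "subst \<sigma> p =
     (\<Sum>m\<in>Poly_Mapping.keys p.
        of_int (Poly_Mapping.lookup p m) *
        (\<Prod>v\<in>Poly_Mapping.keys m. \<sigma> v ^ Poly_Mapping.lookup m v))"

text \<open>Substitution of \<open>f i\<close> for $x_i$ and \<open>g j\<close> for $y_j$; the variables $A$ and $B$ are kept.\<close>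

definition subst_XY :: "(nat \<Rightarrow> pol) \<Rightarrow> (nat \<Rightarrow> pol) \<Rightarrow> pol \<Rightarrow> pol" where
  "subst_XY f g = subst (\<lambda>v. case v of X_var i \<Rightarrow> f i | Y_var j \<Rightarrow> g j | A_var \<Rightarrow> pA | B_var \<Rightarrow> pB)"

text \<open>The degree in a single variable; the zero polynomial is given degree 0.\<close>

definition degree_in :: "var \<Rightarrow> pol \<Rightarrow> nat" where
  "degree_in v p = Max (insert 0 ((\<lambda>m. Poly_Mapping.lookup m v) ` Poly_Mapping.keys p))"

definition leading_form :: "var \<Rightarrow> pol \<Rightarrow> pol" where
  "leading_form v p =
     (\<Sum>m\<in>{m \<in> Poly_Mapping.keys p. Poly_Mapping.lookup m v = degree_in v p}.
        Poly_Mapping.single m (Poly_Mapping.lookup p m))"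

text \<open>The summand \<open>q\<close> of \<open>p\<close> has a term among those making up the \<open>v\<close>-leading form of \<open>p\<close>.\<close>

definition contributes :: "var \<Rightarrow> pol \<Rightarrow> pol \<Rightarrow> bool" where
  "contributes v q p \<longleftrightarrow>
     (\<exists>m\<in>Poly_Mapping.keys q. Poly_Mapping.lookup m v = degree_in v p)"


section \<open>Permutations and double Schubert polynomials\<close>

text \<open>A permutation in $\mathcal{S}_n$ is a function \<open>w\<close> with \<open>w permutes {1..n}\<close>.\<close>

definition coxeter_length :: "nat \<Rightarrow> (nat \<Rightarrow> nat) \<Rightarrow> nat" where
  "coxeter_length n w = card {(i, j). 1 \<le> i \<and> i < j \<and> j \<le> n \<and> w i > w j}"

definition longest_perm :: "nat \<Rightarrow> nat \<Rightarrow> nat" where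
  "longest_perm n = (\<lambda>i. if i \<in> {1..n} then n + 1 - i else i)"

text \<open>
  The divided difference $(p - s_i p) / (x_i - x_{i+1})$, where $s_i$ exchanges $x_i$ and
  $x_{i+1}$.  The quotient exists and is unique.
\<close>

definition divided_difference :: "nat \<Rightarrow> pol \<Rightarrow> pol" where
  "divided_difference i p =
     (THE q. (pX i - pX (i + 1)) * q = p - subst_XY (\<lambda>k. pX (transpose i (i + 1) k)) pY p)"

text \<open>
  The polynomials obtained from $S_{w_0}$ by divided differences, each labelled by the permutation
  it belongs to: $S_{w s_i} = \partial_i S_w$ whenever $w(i) > w(i+1)$.  Since divided differences
  satisfy the braid relations, every permutation receives exactly one polynomial.
\<close>

inductive is_double_schubert :: "nat \<Rightarrow> (nat \<Rightarrow> nat) \<Rightarrow> pol \<Rightarrow> bool" for n :: nat where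
  top: "is_double_schubert n (longest_perm n)
          (\<Prod>(i, j)\<in>{(i, j). i \<in> {1..n} \<and> j \<in> {1..n} \<and> i + j \<le> n}. pX i - pY j)"
| down: "is_double_schubert n w p \<Longrightarrow> 1 \<le> i \<Longrightarrow> i < n \<Longrightarrow> w i > w (i + 1) \<Longrightarrow>
          is_double_schubert n (w \<circ> transpose i (i + 1)) (divided_difference i p)"

definition double_schubert :: "nat \<Rightarrow> (nat \<Rightarrow> nat) \<Rightarrow> pol" where
  "double_schubert n w = (THE p. is_double_schubert n w p)"


section \<open>Generic pipe dreams\<close>

datatype side = West | North | South | East

datatype tile = Bump | Cross | ElbowJ | ElbowR | Horizontal | Vertical | Blank

text \<open>Each pipe of a tile is directed: it enters at the West or South and leaves at the North or East.\<close>

fun pipes :: "tile \<Rightarrow> (side \<times> side) set" where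
  "pipes Bump = {(West, North), (South, East)}"
| "pipes Cross = {(West, East), (South, North)}"
| "pipes ElbowJ = {(West, North)}"
| "pipes ElbowR = {(South, East)}"
| "pipes Horizontal = {(West, East)}"
| "pipes Vertical = {(South, North)}"
| "pipes Blank = {}"

definition meets :: "tile \<Rightarrow> side \<Rightarrow> bool" where
  "meets t s \<longleftrightarrow> s \<in> Field (pipes t)"

text \<open>Rows are counted from the top, columns from the left.\<close>

type_synonym grid = "nat \<times> nat \<Rightarrow> tile"

definition valid_filling :: "nat \<Rightarrow> grid \<Rightarrow> bool" where
  "valid_filling n \<delta> \<longleftrightarrow>
     \<delta> \<in> ({1..n} \<times> {1..n}) \<rightarrow>\<^sub>E UNIV \<and>
     (\<forall>i\<in>{1..n}. \<forall>j\<in>{1..<n}. meets (\<delta> (i, j)) East \<longleftrightarrow> meets (\<delta> (i, j + 1)) West) \<and>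
     (\<forall>i\<in>{1..<n}. \<forall>j\<in>{1..n}. meets (\<delta> (i, j)) South \<longleftrightarrow> meets (\<delta> (i + 1, j)) North) \<and>
     (\<forall>i\<in>{1..n}. meets (\<delta> (i, 1)) West \<and> \<not> meets (\<delta> (i, n)) East) \<and>
     (\<forall>j\<in>{1..n}. meets (\<delta> (1, j)) North \<and> \<not> meets (\<delta> (n, j)) South)"

text \<open>
  \<open>pipe_enters n \<delta> k c s\<close>: the pipe labelled \<open>k\<close>, followed from the West edge of row \<open>k\<close>, enters
  cell \<open>c\<close> through its side \<open>s\<close>.  Entering the fictitious cell \<open>(0, j)\<close> from the South means
  leaving the grid through the North edge of column \<open>j\<close>.
\<close>

inductive pipe_enters :: "nat \<Rightarrow> grid \<Rightarrow> nat \<Rightarrow> nat \<times> nat \<Rightarrow> side \<Rightarrow> bool"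
  for n :: nat and \<delta> :: grid and k :: nat where
  start: "k \<in> {1..n} \<Longrightarrow> pipe_enters n \<delta> k (k, 1) West"
| right: "pipe_enters n \<delta> k (i, j) s \<Longrightarrow> i \<in> {1..n} \<Longrightarrow> j \<in> {1..n} \<Longrightarrow>
          (s, East) \<in> pipes (\<delta> (i, j)) \<Longrightarrow> pipe_enters n \<delta> k (i, j + 1) West"
| up: "pipe_enters n \<delta> k (i, j) s \<Longrightarrow> i \<in> {1..n} \<Longrightarrow> j \<in> {1..n} \<Longrightarrow>
          (s, North) \<in> pipes (\<delta> (i, j)) \<Longrightarrow> pipe_enters n \<delta> k (i - 1, j) South"

definition GPDs :: "nat \<Rightarrow> (nat \<Rightarrow> nat) \<Rightarrow> grid set" where
  "GPDs n w = {\<delta>. valid_filling n \<delta> \<and> (\<forall>k\<in>{1..n}. pipe_enters n \<delta> k (0, w k) South)}"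

definition cross_at :: "nat \<Rightarrow> grid \<Rightarrow> nat \<Rightarrow> nat \<Rightarrow> nat \<times> nat \<Rightarrow> bool" where
  "cross_at n \<delta> k l c \<longleftrightarrow>
     c \<in> {1..n} \<times> {1..n} \<and> \<delta> c = Cross \<and>
     (pipe_enters n \<delta> k c West \<and> pipe_enters n \<delta> l c South \<or>
      pipe_enters n \<delta> l c West \<and> pipe_enters n \<delta> k c South)"

definition no_double_crossing :: "nat \<Rightarrow> grid \<Rightarrow> bool" where
  "no_double_crossing n \<delta> \<longleftrightarrow>
     (\<forall>k\<in>{1..n}. \<forall>l\<in>{1..n}. k \<noteq> l \<longrightarrow>
        \<not> (\<exists>c d. c \<noteq> d \<and> cross_at n \<delta> k l c \<and> cross_at n \<delta> k l d))"

fun tile_weight :: "nat \<Rightarrow> nat \<Rightarrow> tile \<Rightarrow> pol" where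
  "tile_weight i j Cross = pA + pX i - pY j"
| "tile_weight i j Vertical = pA + pX i - pY j"
| "tile_weight i j Horizontal = pA + pX i - pY j"
| "tile_weight i j Blank = pB - pX i + pY j"
| "tile_weight i j Bump = pA + pB"
| "tile_weight i j ElbowJ = pA + pB"
| "tile_weight i j ElbowR = pA + pB"

definition wt :: "nat \<Rightarrow> grid \<Rightarrow> pol" where
  "wt n \<delta> = (\<Prod>(i, j)\<in>{1..n} \<times> {1..n}. tile_weight i j (\<delta> (i, j)))"

definition GPD_poly :: "nat \<Rightarrow> (nat \<Rightarrow> nat) \<Rightarrow> pol" where
  "GPD_poly n w = (\<Sum>\<delta>\<in>GPDs n w. wt n \<delta>)"

end

theory Submission
  imports Defs "HOL-Computational_Algebra.Polynomial"
begin

text \<open>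
  Label every edge by the pipe through it, or by 0.  Put \<open>h = A + B\<close> and
  \<open>u = A + x\<^sub>i - y\<^sub>j\<close>.  A cell either keeps the labels of its west and south edges (weight \<open>h\<close>)
  or exchanges them (weight \<open>u\<close>), so it acts as \<open>h + u s\<close> with a transposition \<open>s\<close>; giving the
  exchange of two zeros the sign -1 accounts for the weight \<open>h - u\<close> of a blank tile.  These operators
  satisfy the Yang--Baxter equation, and moving \<open>h + (x\<^sub>i\<^sub>+\<^sub>1 - x\<^sub>i) s\<close> through rows \<open>i\<close>, \<open>i + 1\<close> from
  west to east gives, with \<open>s\<^sub>i\<close> acting on the \<open>x\<close> variables,
  \<open>(x\<^sub>i - x\<^sub>i\<^sub>+\<^sub>1) (G\<^bsub>w s\<^sub>i\<^esub> + s\<^sub>i G\<^sub>w) = (A + B) (G\<^sub>w - s\<^sub>i G\<^sub>w)\<close>.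

  Each inversion of \<open>w\<close> forces an odd number of crossings, and flux conservation shows that there are
  as many blanks as crosses and bumps together.  Hence the \<open>B\<close>-degree of a weight is \<open>n\<^sup>2\<close> minus the
  number of straight tiles, its \<open>A\<close>-degree is \<open>n\<^sup>2\<close> minus the number of blanks, both are at most
  \<open>n\<^sup>2 - \<ell>(w)\<close>, and equality characterizes the two classes of pipe dreams.  In top degree the
  relation becomes the divided difference recursion.  Its initial value is read off from the only
  reduced filling for \<open>w\<^sub>0\<close>.
\<close>

section \<open>Yang--Baxter operators on label sequences\<close>

text \<open>In \<open>gpd_sum\<close> the quantities \<open>h\<close>, \<open>u\<close>,
  \<open>y\<close> may lie in any commutative ring, so one exchange relation serves twice, with
  \<open>h\<close> the indeterminate \<open>[:0, 1:]\<close> of a univariate polynomial ring. If the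
  row parameters are constant in \<open>h\<close>, exactly the straight tiles have constant weight;
  if they are \<open>h\<close> plus a constant, exactly the blanks do. All other tiles are then
  monic of degree one in \<open>h\<close>, and differences of row parameters stay constant.

  Two points need an argument of their own. The degrees and the value at
  \<open>longest_perm n\<close> require minimal pipe dreams to exist, and none is constructed for
  general \<open>w\<close>: with positive integer weights a sum over minimal pipe dreams vanishes
  only if it is empty, so the recursion carries existence from the identity upwards in length.
  Moreover \<open>double_schubert\<close> is a definite description, whose uniqueness usually rests
  on the braid relations of divided differences; here any family with the right top value and the
  right recursion yields uniqueness, and the sums over minimal pipe dreams are such a
  family.\<close>

definition swap_op :: "nat \<Rightarrow> ((nat \<Rightarrow> nat) \<Rightarrow> 'a::comm_ring_1) \<Rightarrow> (nat \<Rightarrow> nat) \<Rightarrow> 'a" where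
  "swap_op p F s = (if s p = 0 \<and> s (Suc p) = 0 then - 1 else 1) * F (s \<circ> transpose p (Suc p))"

definition R_op :: "'a::comm_ring_1 \<Rightarrow> nat \<Rightarrow> 'a \<Rightarrow> ((nat \<Rightarrow> nat) \<Rightarrow> 'a) \<Rightarrow> (nat \<Rightarrow> nat) \<Rightarrow> 'a" where
  "R_op h p u F s = h * F s + u * swap_op p F s"

lemma swap_op_linear:
  "swap_op p (\<lambda>s. F s + G s) s = swap_op p F s + swap_op p G s"
  "swap_op p (\<lambda>s. a * F s) s = a * swap_op p F s"
  by (simp_all add: swap_op_def algebra_simps)

text \<open>The sign depends only on the unordered pair of labels at \<open>p\<close> and
  \<open>Suc p\<close>, so it occurs twice and cancels.\<close>

lemma swap_op_swap_op: "swap_op p (swap_op p F) = F"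
proof
  fix s :: "nat \<Rightarrow> nat"
  have "s \<circ> transpose p (Suc p) \<circ> transpose p (Suc p) = s"
    by (simp add: fun_eq_iff)
  then show "swap_op p (swap_op p F) s = F s" by (simp add: swap_op_def)
qed

lemma swap_op_commute:
  assumes "Suc p < q"
  shows "swap_op p (swap_op q F) = swap_op q (swap_op p F)"
proof
  fix s :: "nat \<Rightarrow> nat"
  have "s \<circ> transpose p (Suc p) \<circ> transpose q (Suc q) = s \<circ> transpose q (Suc q) \<circ> transpose p (Suc p)"
    using assms by (auto simp: fun_eq_iff transpose_def)
  then show "swap_op p (swap_op q F) s = swap_op q (swap_op p F) s"
    using assms by (simp add: swap_op_def transpose_def)
qed

text \<open>Each side exchanges every pair among the three labels exactly once, so the signs agree
  as well.\<close>

lemma swap_op_braid: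
  "swap_op p (swap_op (Suc p) (swap_op p F)) = swap_op (Suc p) (swap_op p (swap_op (Suc p) F))"
proof
  fix s :: "nat \<Rightarrow> nat"
  have "s \<circ> transpose p (Suc p) \<circ> transpose (Suc p) (Suc (Suc p)) \<circ> transpose p (Suc p)
      = s \<circ> transpose (Suc p) (Suc (Suc p)) \<circ> transpose p (Suc p) \<circ> transpose (Suc p) (Suc (Suc p))"
    by (auto simp: fun_eq_iff transpose_def)
  then show "swap_op p (swap_op (Suc p) (swap_op p F)) s = swap_op (Suc p) (swap_op p (swap_op (Suc p) F)) s"
    by (simp add: swap_op_def transpose_def)
qed

lemma R_op_eq: "R_op h p u F = (\<lambda>s. h * F s + u * swap_op p F s)"
  by (simp add: R_op_def fun_eq_iff)

lemma R_op_commute: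
  assumes "Suc p < q"
  shows "R_op h p u (R_op h q v F) = R_op h q v (R_op h p u F)"
  by (simp add: R_op_eq swap_op_linear swap_op_commute[OF assms] fun_eq_iff algebra_simps)

text \<open>Expand in powers of \<open>h\<close>: the linear coefficients agree because a swap
  squares to the identity, the constant ones by the braid relation; in the quadratic ones both swaps
  get the factor \<open>a + b\<close>.\<close>

lemma R_op_Yang_Baxter:
  "R_op h p a (R_op h (Suc p) (a + b) (R_op h p b F)) =
   R_op h (Suc p) b (R_op h p (a + b) (R_op h (Suc p) a F))"
  by (simp add: R_op_eq swap_op_linear swap_op_braid swap_op_swap_op fun_eq_iff algebra_simps)

text \<open>The operators act on functions of the state, so the outermost factor is the cell read
  first. Here that is the westernmost cell of the row, at position \<open>p\<close>.\<close>

primrec row_op :: "'a::comm_ring_1 \<Rightarrow> nat \<Rightarrow> 'a \<Rightarrow> (nat \<Rightarrow> 'a) \<Rightarrow> nat \<Rightarrow>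
    ((nat \<Rightarrow> nat) \<Rightarrow> 'a) \<Rightarrow> (nat \<Rightarrow> nat) \<Rightarrow> 'a" where
  "row_op h p u y 0 F = F"
| "row_op h p u y (Suc m) F = row_op h p u y m (R_op h (p + m) (u - y (Suc m)) F)"

lemma row_op_R_op_commute:
  assumes "p + m < q"
  shows "row_op h p u y m (R_op h q v F) = R_op h q v (row_op h p u y m F)"
  using assms by (induction m arbitrary: F) (simp_all add: R_op_commute)

lemma R_op_row_op_commute:
  assumes "Suc q < p"
  shows "row_op h p u y m (R_op h q v F) = R_op h q v (row_op h p u y m F)"
  using assms by (induction m arbitrary: F) (simp_all flip: R_op_commute)

text \<open>Columns are peeled off from the east. In the last column the Yang--Baxter equation
  applies since its middle parameter \<open>u' - y (Suc m)\<close> is the sum of the outer ones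
  \<open>u' - u\<close> and \<open>u - y (Suc m)\<close>.\<close>

lemma row_op_exchange:
  "R_op h p (u' - u) (row_op h (Suc p) u' y m (row_op h p u y m F)) =
   row_op h (Suc p) u y m (row_op h p u' y m (R_op h (p + m) (u' - u) F))"
proof (induction m arbitrary: F)
  case 0
  then show ?case by simp
next
  case (Suc m)
  let ?R = "R_op h" and ?v = "u - y (Suc m)" and ?v' = "u' - y (Suc m)" and ?d = "u' - u"
  have "?R p ?d (row_op h (Suc p) u' y (Suc m) (row_op h p u y (Suc m) F))
      = ?R p ?d (row_op h (Suc p) u' y m (row_op h p u y m (?R (Suc (p + m)) ?v' (?R (p + m) ?v F))))"
    by (simp add: row_op_R_op_commute)
  also have "\<dots> = row_op h (Suc p) u y m (row_op h p u' y m
                    (?R (p + m) ?d (?R (Suc (p + m)) (?d + ?v) (?R (p + m) ?v F))))"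
    by (simp add: Suc.IH)
  also have "\<dots> = row_op h (Suc p) u y m (row_op h p u' y m
                    (?R (Suc (p + m)) ?v (?R (p + m) ?v' (?R (Suc (p + m)) ?d F))))"
    by (simp only: R_op_Yang_Baxter) simp
  also have "\<dots> = row_op h (Suc p) u y (Suc m) (row_op h p u' y (Suc m) (?R (p + Suc m) ?d F))"
    by (simp add: row_op_R_op_commute)
  finally show ?case .
qed

text \<open>Row \<open>i\<close> starts at position \<open>i\<close>, and the bottom row is
  outermost, that is, read first.\<close>

primrec grid_op :: "nat \<Rightarrow> 'a::comm_ring_1 \<Rightarrow> (nat \<Rightarrow> 'a) \<Rightarrow> (nat \<Rightarrow> 'a) \<Rightarrow> nat \<Rightarrow>
    ((nat \<Rightarrow> nat) \<Rightarrow> 'a) \<Rightarrow> (nat \<Rightarrow> nat) \<Rightarrow> 'a" where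
  "grid_op n h u y 0 F = F"
| "grid_op n h u y (Suc m) F = row_op h (Suc m) (u (Suc m)) y n (grid_op n h u y m F)"

lemma grid_op_cong:
  assumes "\<And>i. 1 \<le> i \<Longrightarrow> i \<le> m \<Longrightarrow> u i = u' i"
  shows "grid_op n h u y m F = grid_op n h u' y m F"
  using assms by (induction m) auto

lemma grid_op_R_op_commute:
  assumes "m + n < q"
  shows "grid_op n h u y m (R_op h q v F) = R_op h q v (grid_op n h u y m F)"
  using assms by (induction m) (simp_all add: row_op_R_op_commute)

lemma grid_op_exchange:
  assumes "1 \<le> i" "i < m"
  shows "R_op h i (u (i + 1) - u i) (grid_op n h u y m F) =
         grid_op n h (u \<circ> transpose i (i + 1)) y m (R_op h (i + n) (u (i + 1) - u i) F)"
  using assms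
proof (induction m)
  case 0
  then show ?case by simp
next
  case (Suc m)
  show ?case
  \<comment> \<open>For \<open>i = m\<close> the two rows concerned are the outermost ones, and the
    operator emerging at \<open>i + n\<close> still has to pass the rows with index below
    \<open>i\<close>. Otherwise the operator at \<open>i\<close> first passes row
    \<open>Suc m\<close>, whose positions all exceed \<open>i + 1\<close>.\<close>
  proof (cases "i = m")
    case True
    then obtain k where k: "m = Suc k" "i = Suc k" using Suc.prems by (cases i) auto
    have "grid_op n h u y k G = grid_op n h (u \<circ> transpose i (i + 1)) y k G" for G :: "(nat \<Rightarrow> nat) \<Rightarrow> 'a"
      using k by (intro grid_op_cong) (auto simp: transpose_def)
    moreover have "grid_op n h v y k (R_op h (i + n) d F) = R_op h (i + n) d (grid_op n h v y k F)" for v d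
      using k by (intro grid_op_R_op_commute) simp
    ultimately show ?thesis
      using k by (simp add: row_op_exchange comp_def)
  next
    case False
    then have "R_op h i (u (i + 1) - u i) (grid_op n h u y (Suc m) F) =
        row_op h (Suc m) (u (Suc m)) y n (R_op h i (u (i + 1) - u i) (grid_op n h u y m F))"
      using Suc.prems by (simp add: R_op_row_op_commute)
    with False Suc show ?thesis by (simp add: transpose_def)
  qed
qed

lemma swap_op_relabel:
  assumes "\<And>a. g a = 0 \<longleftrightarrow> a = 0"
  shows "swap_op p F (g \<circ> s) = swap_op p (\<lambda>s. F (g \<circ> s)) s"
  using assms by (simp add: swap_op_def comp_assoc)

lemma row_op_relabel:
  assumes "\<And>a. g a = 0 \<longleftrightarrow> a = 0"
  shows "row_op h p u y m F (g \<circ> s) = row_op h p u y m (\<lambda>s. F (g \<circ> s)) s"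
proof (induction m arbitrary: F)
  case (Suc m)
  have "(\<lambda>s. R_op h q v F (g \<circ> s)) = R_op h q v (\<lambda>s. F (g \<circ> s))" for q v
    by (rule ext) (simp only: R_op_def swap_op_relabel[OF assms])
  with Suc show ?case by (simp add: comp_def)
qed simp

text \<open>The operators see of a label only whether it is 0. This converts an exchange of two
  starting labels into a renaming of pipes, hence into a change of \<open>w\<close>.\<close>

lemma grid_op_relabel:
  assumes "\<And>a. g a = 0 \<longleftrightarrow> a = 0"
  shows "grid_op n h u y m F (g \<circ> s) = grid_op n h u y m (\<lambda>s. F (g \<circ> s)) s"
  by (induction m arbitrary: s) (simp_all add: row_op_relabel[OF assms])

section \<open>Labels of the edges of a filling\<close>

definition straight :: "tile \<Rightarrow> bool" where
  "straight t \<longleftrightarrow> t \<in> {Cross, Horizontal, Vertical}"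

lemma straight_simps [simp]:
  "straight Cross" "straight Horizontal" "straight Vertical"
  "\<not> straight Bump" "\<not> straight ElbowJ" "\<not> straight ElbowR" "\<not> straight Blank"
  by (simp_all add: straight_def)

lemma meets_iff:
  "meets t West \<longleftrightarrow> t \<in> {Bump, Cross, ElbowJ, Horizontal}"
  "meets t South \<longleftrightarrow> t \<in> {Bump, Cross, ElbowR, Vertical}"
  "meets t North \<longleftrightarrow> t \<in> {Bump, Cross, ElbowJ, Vertical}"
  "meets t East \<longleftrightarrow> t \<in> {Bump, Cross, ElbowR, Horizontal}"
  by (cases t; auto simp: meets_def Field_def)+

text \<open>Besides \<open>straight\<close> this determines the tile: each pattern of present and
  absent labels admits one straight and one other tile, except that two absent labels leave only
  \<open>Blank\<close>.\<close>

definition fits :: "nat \<Rightarrow> nat \<Rightarrow> tile \<Rightarrow> bool" where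
  "fits a b t \<longleftrightarrow> (meets t West \<longleftrightarrow> a \<noteq> 0) \<and> (meets t South \<longleftrightarrow> b \<noteq> 0)"

lemma fits_meets_out:
  assumes "fits a b t"
  shows "meets t North \<longleftrightarrow> (if straight t then b else a) \<noteq> 0"
    and "meets t East \<longleftrightarrow> (if straight t then a else b) \<noteq> 0"
  using assms by (cases t; simp add: fits_def meets_iff)+

text \<open>The pair consists of the labels on the north and the east edge. It is computed for every
  grid, from \<open>i\<close> on the west boundary and 0 on the south boundary; whether the tiles
  match these labels is expressed separately by \<open>labelled\<close>.\<close>

function out_labels :: "nat \<Rightarrow> grid \<Rightarrow> nat \<Rightarrow> nat \<Rightarrow> nat \<times> nat" where
  "out_labels n \<delta> i j =
     (let a = if j \<le> 1 then i else snd (out_labels n \<delta> i (j - 1));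
          b = if i \<ge> n then 0 else fst (out_labels n \<delta> (Suc i) j)
      in if straight (\<delta> (i, j)) then (b, a) else (a, b))"
  by pat_completeness auto
termination
  by (relation "measure (\<lambda>(n, \<delta>, i, j). n - i + j)") auto

declare out_labels.simps [simp del]

definition west_label :: "nat \<Rightarrow> grid \<Rightarrow> nat \<Rightarrow> nat \<Rightarrow> nat" where
  "west_label n \<delta> i j = (if j \<le> 1 then i else snd (out_labels n \<delta> i (j - 1)))"

definition south_label :: "nat \<Rightarrow> grid \<Rightarrow> nat \<Rightarrow> nat \<Rightarrow> nat" where
  "south_label n \<delta> i j = (if i \<ge> n then 0 else fst (out_labels n \<delta> (Suc i) j))"

lemma west_label_first [simp]: "west_label n \<delta> i (Suc 0) = i"
  by (simp add: west_label_def)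

lemma south_label_last [simp]: "south_label n \<delta> n j = 0"
  by (simp add: south_label_def)

lemma west_label_step:
  "1 \<le> j \<Longrightarrow> west_label n \<delta> i (Suc j) =
     (if straight (\<delta> (i, j)) then west_label n \<delta> i j else south_label n \<delta> i j)"
  by (simp add: west_label_def south_label_def out_labels.simps[of n \<delta> i j] Let_def)

lemma south_label_step:
  "i < n \<Longrightarrow> south_label n \<delta> i j =
     (if straight (\<delta> (Suc i, j)) then south_label n \<delta> (Suc i) j else west_label n \<delta> (Suc i) j)"
  by (simp add: west_label_def south_label_def out_labels.simps[of n \<delta> "Suc i" j] Let_def)

text \<open>Induction along the pipes, starting in the south-west corner.\<close>

lemma grid_induct [consumes 2, case_names cell]:
  assumes "i \<in> {1..n}" "j \<in> {1..n}"
    and "\<And>i j. i \<in> {1..n} \<Longrightarrow> j \<in> {1..n} \<Longrightarrow> (1 < j \<Longrightarrow> P i (j - 1)) \<Longrightarrow> (i < n \<Longrightarrow> P (Suc i) j) \<Longrightarrow> P i j"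
  shows "P i j"
  using assms(1,2)
proof (induction "n - i + j" arbitrary: i j rule: less_induct)
  case less
  show ?case
  proof (rule assms(3)[OF less.prems])
    show "P i (j - 1)" if "1 < j" using that less.prems by (intro less.hyps) auto
    show "P (Suc i) j" if "i < n" using that less.prems by (intro less.hyps) auto
  qed
qed

definition labelled :: "nat \<Rightarrow> grid \<Rightarrow> bool" where
  "labelled n \<delta> \<longleftrightarrow> (\<forall>i\<in>{1..n}. \<forall>j\<in>{1..n}. fits (west_label n \<delta> i j) (south_label n \<delta> i j) (\<delta> (i, j)))"

lemma labelled_meets:
  assumes "labelled n \<delta>" "i \<in> {1..n}" "j \<in> {1..n}"
  shows "meets (\<delta> (i, j)) West \<longleftrightarrow> west_label n \<delta> i j \<noteq> 0"
    and "meets (\<delta> (i, j)) South \<longleftrightarrow> south_label n \<delta> i j \<noteq> 0"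
    and "meets (\<delta> (i, j)) North \<longleftrightarrow> south_label n \<delta> (i - 1) j \<noteq> 0"
    and "meets (\<delta> (i, j)) East \<longleftrightarrow> west_label n \<delta> i (Suc j) \<noteq> 0"
proof -
  have f: "fits (west_label n \<delta> i j) (south_label n \<delta> i j) (\<delta> (i, j))"
    using assms by (auto simp: labelled_def)
  then show "meets (\<delta> (i, j)) West \<longleftrightarrow> west_label n \<delta> i j \<noteq> 0"
    and "meets (\<delta> (i, j)) South \<longleftrightarrow> south_label n \<delta> i j \<noteq> 0"
    by (auto simp: fits_def)
  have "Suc (i - 1) = i" "i - 1 < n" using assms by auto
  then show "meets (\<delta> (i, j)) North \<longleftrightarrow> south_label n \<delta> (i - 1) j \<noteq> 0"
    using fits_meets_out(1)[OF f] by (simp add: south_label_step)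
  show "meets (\<delta> (i, j)) East \<longleftrightarrow> west_label n \<delta> i (Suc j) \<noteq> 0"
    using fits_meets_out(2)[OF f] assms(3) by (simp add: west_label_step)
qed

lemma valid_filling_labelled:
  assumes "valid_filling n \<delta>"
  shows "labelled n \<delta>"
proof -
  have "fits (west_label n \<delta> i j) (south_label n \<delta> i j) (\<delta> (i, j))"
    if "i \<in> {1..n}" "j \<in> {1..n}" for i j
    using that
  proof (induction rule: grid_induct)
    case (cell i j)
    have "meets (\<delta> (i, j)) West \<longleftrightarrow> west_label n \<delta> i j \<noteq> 0"
    proof (cases "j = 1")
      case True
      then show ?thesis using assms cell.hyps by (auto simp: valid_filling_def)
    next
      case False
      then obtain k where k: "j = Suc k" "k \<in> {1..<n}" using cell.hyps by (cases j) auto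
      then have "meets (\<delta> (i, k)) East \<longleftrightarrow> meets (\<delta> (i, k + 1)) West"
        using assms cell.hyps unfolding valid_filling_def by blast
      then show ?thesis
        using k cell.IH(1) fits_meets_out(2) by (simp add: west_label_step)
    qed
    moreover have "meets (\<delta> (i, j)) South \<longleftrightarrow> south_label n \<delta> i j \<noteq> 0"
    proof (cases "i = n")
      case True
      then show ?thesis using assms cell.hyps by (auto simp: valid_filling_def)
    next
      case False
      then have "i \<in> {1..<n}" using cell.hyps by auto
      then have "meets (\<delta> (i, j)) South \<longleftrightarrow> meets (\<delta> (i + 1, j)) North"
        using assms cell.hyps unfolding valid_filling_def by blast
      then show ?thesis
        using \<open>i \<in> {1..<n}\<close> cell.IH(2) fits_meets_out(1) by (simp add: south_label_step)
    qed
    ultimately show ?case by (simp add: fits_def)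
  qed
  then show ?thesis by (simp add: labelled_def)
qed

text \<open>Neighbouring cells read the same label on their common edge, so \<open>labelled\<close>
  contains the agreement of adjacent tiles and the west and south boundary conditions. Only the
  other two boundaries remain.\<close>

lemma valid_filling_iff:
  "valid_filling n \<delta> \<longleftrightarrow> \<delta> \<in> ({1..n} \<times> {1..n}) \<rightarrow>\<^sub>E UNIV \<and> labelled n \<delta> \<and>
     (\<forall>i\<in>{1..n}. west_label n \<delta> i (Suc n) = 0) \<and> (\<forall>j\<in>{1..n}. south_label n \<delta> 0 j \<noteq> 0)"
  (is "?L \<longleftrightarrow> ?R")
proof
  assume L: ?L
  have lab: "labelled n \<delta>" by (rule valid_filling_labelled[OF L])
  have "west_label n \<delta> i (Suc n) = 0" if "i \<in> {1..n}" for i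
    using labelled_meets(4)[OF lab that, of n] L that by (auto simp: valid_filling_def)
  moreover have "south_label n \<delta> 0 j \<noteq> 0" if "j \<in> {1..n}" for j
    using labelled_meets(3)[OF lab _ that, of 1] L that by (auto simp: valid_filling_def)
  ultimately show ?R using L lab by (auto simp: valid_filling_def)
next
  assume R: ?R
  then have lab: "labelled n \<delta>" by blast
  note m = labelled_meets[OF lab]
  show ?L
    unfolding valid_filling_def
  proof (intro conjI ballI)
    show "\<delta> \<in> ({1..n} \<times> {1..n}) \<rightarrow>\<^sub>E UNIV" using R by blast
  qed (use R in \<open>auto simp: m\<close>)
qed

lemma pipe_enters_label:
  assumes "pipe_enters n \<delta> k c s"
  shows "(s = West \<and> fst c \<in> {1..n} \<and> 1 \<le> snd c \<and> west_label n \<delta> (fst c) (snd c) = k \<or>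
          s = South \<and> fst c < n \<and> south_label n \<delta> (fst c) (snd c) = k) \<and> k \<in> {1..n}"
  using assms
proof (induction rule: pipe_enters.induct)
  case (right i j s)
  then show ?case by (cases "\<delta> (i, j)") (auto simp: west_label_step)
next
  case (up i j s)
  then have "Suc (i - 1) = i" "i - 1 < n" by auto
  with up show ?case by (cases "\<delta> (i, j)") (auto simp: south_label_step)
qed auto

text \<open>A label on an outgoing edge comes from an incoming edge with the same label, and since
  it is nonzero, \<open>fits\<close> ensures that the tile has the pipe joining these edges.\<close>

lemma pipe_through:
  assumes "labelled n \<delta>" "i \<in> {1..n}" "j \<in> {1..n}" "k \<noteq> 0"
    and "west_label n \<delta> i j = k \<Longrightarrow> pipe_enters n \<delta> k (i, j) West"
    and "south_label n \<delta> i j = k \<Longrightarrow> pipe_enters n \<delta> k (i, j) South"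
  shows "west_label n \<delta> i (Suc j) = k \<Longrightarrow> pipe_enters n \<delta> k (i, Suc j) West"
    and "south_label n \<delta> (i - 1) j = k \<Longrightarrow> pipe_enters n \<delta> k (i - 1, j) South"
proof -
  have f: "fits (west_label n \<delta> i j) (south_label n \<delta> i j) (\<delta> (i, j))"
    using assms by (auto simp: labelled_def)
  {
    assume "west_label n \<delta> i (Suc j) = k"
    then have "if straight (\<delta> (i, j)) then west_label n \<delta> i j = k else south_label n \<delta> i j = k"
      using assms(3) by (simp add: west_label_step split: if_splits)
    then show "pipe_enters n \<delta> k (i, Suc j) West"
      using f assms pipe_enters.right[of n \<delta> k i j West] pipe_enters.right[of n \<delta> k i j South]
      by (cases "\<delta> (i, j)") (auto simp: fits_def meets_iff)
  }
  {
    assume *: "south_label n \<delta> (i - 1) j = k"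
    have "Suc (i - 1) = i" "i - 1 < n" using assms by auto
    with * have "if straight (\<delta> (i, j)) then south_label n \<delta> i j = k else west_label n \<delta> i j = k"
      using assms(3) by (simp add: south_label_step split: if_splits)
    then show "pipe_enters n \<delta> k (i - 1, j) South"
      using f assms pipe_enters.up[of n \<delta> k i j West] pipe_enters.up[of n \<delta> k i j South]
      by (cases "\<delta> (i, j)") (auto simp: fits_def meets_iff)
  }
qed

lemma label_pipe_enters:
  assumes "labelled n \<delta>" "i \<in> {1..n}" "j \<in> {1..n}" "k \<noteq> 0"
  shows "(west_label n \<delta> i j = k \<longrightarrow> pipe_enters n \<delta> k (i, j) West) \<and>
         (south_label n \<delta> i j = k \<longrightarrow> pipe_enters n \<delta> k (i, j) South)"
  using assms(2,3)
proof (induction rule: grid_induct)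
  case (cell i j)
  have "pipe_enters n \<delta> k (i, j) West" if "west_label n \<delta> i j = k"
  proof (cases "j = 1")
    case True
    then show ?thesis using that cell.hyps pipe_enters.start[of k n \<delta>] by simp
  next
    case False
    then have "Suc (j - 1) = j" "j - 1 \<in> {1..n}" "1 < j" using cell.hyps by auto
    then show ?thesis
      using pipe_through(1)[OF assms(1) cell.hyps(1) _ assms(4), of "j - 1"] cell.IH(1) that by auto
  qed
  moreover have "pipe_enters n \<delta> k (i, j) South" if "south_label n \<delta> i j = k"
  proof (cases "i = n")
    case True
    then show ?thesis using that assms(4) by auto
  next
    case False
    then have "Suc i \<in> {1..n}" "i < n" using cell.hyps by auto
    then show ?thesis
      using pipe_through(2)[OF assms(1) _ cell.hyps(2) assms(4), of "Suc i"] cell.IH(2) that by auto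
  qed
  ultimately show ?case by blast
qed

lemma label_pipe_leaves:
  assumes "labelled n \<delta>" "j \<in> {1..n}" "south_label n \<delta> 0 j = k" "k \<noteq> 0"
  shows "pipe_enters n \<delta> k (0, j) South"
  using pipe_through(2)[OF assms(1) _ assms(2,4), of 1] label_pipe_enters[OF assms(1) _ assms(2,4), of 1]
    assms(2,3) by auto

lemma GPDs_iff:
  assumes "w permutes {1..n}"
  shows "\<delta> \<in> GPDs n w \<longleftrightarrow> \<delta> \<in> ({1..n} \<times> {1..n}) \<rightarrow>\<^sub>E UNIV \<and> labelled n \<delta> \<and>
     (\<forall>i\<in>{1..n}. west_label n \<delta> i (Suc n) = 0) \<and> (\<forall>j\<in>{1..n}. south_label n \<delta> 0 j = inv w j)"
  (is "?L \<longleftrightarrow> ?R")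
proof
  assume L: ?L
  then have "valid_filling n \<delta>" by (simp add: GPDs_def)
  moreover have "south_label n \<delta> 0 j = inv w j" if "j \<in> {1..n}" for j
  proof -
    have "inv w j \<in> {1..n}" using permutes_in_image[OF permutes_inv[OF assms], of j] that by simp
    then have "pipe_enters n \<delta> (inv w j) (0, w (inv w j)) South" using L by (simp add: GPDs_def)
    then have "pipe_enters n \<delta> (inv w j) (0, j) South" by (simp add: permutes_inverses(1)[OF assms])
    from pipe_enters_label[OF this] show ?thesis by simp
  qed
  ultimately show ?R by (simp add: valid_filling_iff)
next
  assume R: ?R
  have nz: "inv w j \<noteq> 0" if "j \<in> {1..n}" for j
    using permutes_in_image[OF permutes_inv[OF assms], of j] that by (auto simp del: permutes_inv)
  have "valid_filling n \<delta>" using R nz by (simp add: valid_filling_iff)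
  moreover have "pipe_enters n \<delta> k (0, w k) South" if "k \<in> {1..n}" for k
  proof -
    have "w k \<in> {1..n}" using permutes_in_image[OF assms, of k] that by simp
    then show ?thesis
      using label_pipe_leaves[of n \<delta> "w k" k] R that permutes_inverses(2)[OF assms, of k] by auto
  qed
  ultimately show ?L by (simp add: GPDs_def)
qed

section \<open>The exchange relation\<close>

text \<open>For \<open>h = A + B\<close> and \<open>u = A + x\<^sub>i - y\<^sub>j\<close> this is the weight of a tile.\<close>

definition tile_wt :: "'a::comm_ring_1 \<Rightarrow> 'a \<Rightarrow> tile \<Rightarrow> 'a" where
  "tile_wt h u t = (if straight t then u else if t = Blank then h - u else h)"

lemma tile_wt_simps [simp]:
  "tile_wt h u Cross = u" "tile_wt h u Horizontal = u" "tile_wt h u Vertical = u"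
  "tile_wt h u Bump = h" "tile_wt h u ElbowJ = h" "tile_wt h u ElbowR = h" "tile_wt h u Blank = h - u"
  by (simp_all add: tile_wt_def)

lemma UNIV_tile: "(UNIV :: tile set) = {Bump, Cross, ElbowJ, ElbowR, Horizontal, Vertical, Blank}"
proof -
  have "t \<in> {Bump, Cross, ElbowJ, ElbowR, Horizontal, Vertical, Blank}" for t
    by (cases t) simp_all
  then show ?thesis by blast
qed

lemma finite_UNIV_tile [simp]: "finite (UNIV :: tile set)"
  by (simp add: UNIV_tile)

text \<open>Cell \<open>(i, j)\<close> acts on the steps \<open>i + j - 1\<close> and \<open>i + j\<close> of the lattice paths through it that run
  from the north-west to the south-east corner.\<close>

definition cell_pos :: "nat \<times> nat \<Rightarrow> nat" where
  "cell_pos c = fst c + snd c - 1"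

primrec leads_to :: "grid \<Rightarrow> (nat \<times> nat) list \<Rightarrow> (nat \<Rightarrow> nat) \<Rightarrow> (nat \<Rightarrow> nat) \<Rightarrow> bool" where
  "leads_to \<delta> [] s t \<longleftrightarrow> s = t"
| "leads_to \<delta> (c # cs) s t \<longleftrightarrow> fits (s (cell_pos c)) (s (Suc (cell_pos c))) (\<delta> c) \<and>
     leads_to \<delta> cs (if straight (\<delta> c) then s \<circ> transpose (cell_pos c) (Suc (cell_pos c)) else s) t"

primrec cells_op :: "'a::comm_ring_1 \<Rightarrow> (nat \<times> nat \<Rightarrow> 'a) \<Rightarrow> (nat \<times> nat) list \<Rightarrow>
    ((nat \<Rightarrow> nat) \<Rightarrow> 'a) \<Rightarrow> (nat \<Rightarrow> nat) \<Rightarrow> 'a" where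
  "cells_op h u [] F = F"
| "cells_op h u (c # cs) F = R_op h (cell_pos c) (u c) (cells_op h u cs F)"

lemma cells_op_append: "cells_op h u (cs @ ds) F = cells_op h u cs (cells_op h u ds F)"
  by (induction cs) simp_all

lemma leads_to_cong:
  assumes "\<And>c. c \<in> set cs \<Longrightarrow> \<delta> c = \<delta>' c"
  shows "leads_to \<delta> cs s t = leads_to \<delta>' cs s t"
  using assms by (induction cs arbitrary: s) auto

text \<open>At most two tiles fit, one keeping and one exchanging the labels. If both labels are 0,
  only \<open>Blank\<close> fits; the exchange then fixes the state and its sign produces
  \<open>h - u\<close>.\<close>

lemma sum_tiles:
  fixes h u :: "'a::comm_ring_1"
  shows "(\<Sum>t\<in>UNIV. if fits (s p) (s (Suc p)) t
            then tile_wt h u t * F (if straight t then s \<circ> transpose p (Suc p) else s) else 0) = R_op h p u F s"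
proof -
  have "s \<circ> transpose p (Suc p) = s" if "s p = 0" "s (Suc p) = 0"
    using that by (auto simp: fun_eq_iff transpose_def)
  then show ?thesis
    by (cases "s p = 0"; cases "s (Suc p) = 0")
       (simp_all add: UNIV_tile fits_def meets_iff R_op_def swap_op_def algebra_simps)
qed

text \<open>Choosing the tile of the first cell is one application of \<open>R_op\<close>. As the
  cells are distinct, the remaining conditions and weights do not involve that tile, and the sum
  factors.\<close>

lemma sum_fillings:
  fixes h :: "'a::comm_ring_1"
  assumes "distinct cs"
  shows "(\<Sum>\<delta> | \<delta> \<in> set cs \<rightarrow>\<^sub>E UNIV \<and> leads_to \<delta> cs s t. \<Prod>c\<in>set cs. tile_wt h (u c) (\<delta> c)) =
         cells_op h u cs (\<lambda>s. if s = t then 1 else 0) s"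
  using assms
proof (induction cs arbitrary: s)
  case Nil
  have "{\<delta> \<in> {} \<rightarrow>\<^sub>E UNIV. s = t} = (if s = t then {\<lambda>x. undefined :: tile} else {})" for \<delta> :: grid
    by auto
  then show ?case by simp
next
  case (Cons c cs)
  let ?s = "\<lambda>x. if straight x then s \<circ> transpose (cell_pos c) (Suc (cell_pos c)) else s"
  let ?ok = "\<lambda>x. fits (s (cell_pos c)) (s (Suc (cell_pos c))) x"
  let ?E = "set cs \<rightarrow>\<^sub>E (UNIV :: tile set)"
  let ?W = "\<lambda>\<delta>. \<Prod>d\<in>set cs. tile_wt h (u d) (\<delta> d)"
  have c: "c \<notin> set cs" using Cons.prems by simp
  have fin: "finite ?E" by (intro finite_PiE) simp_all
  have P: "(\<Prod>d\<in>set (c # cs). tile_wt h (u d) (\<delta> d)) = tile_wt h (u c) (\<delta> c) * ?W \<delta>" for \<delta>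
    using c by simp
  have W: "?W (g(c := x)) = ?W g" for g x
    using c by (intro prod.cong) auto
  have L: "leads_to (g(c := x)) cs s' t = leads_to g cs s' t" for g x s'
    using c by (intro leads_to_cong) auto
  have "(\<Sum>\<delta> | \<delta> \<in> set (c # cs) \<rightarrow>\<^sub>E UNIV \<and> leads_to \<delta> (c # cs) s t. \<Prod>d\<in>set (c # cs). tile_wt h (u d) (\<delta> d))
      = (\<Sum>\<delta>\<in>insert c (set cs) \<rightarrow>\<^sub>E UNIV. if leads_to \<delta> (c # cs) s t then tile_wt h (u c) (\<delta> c) * ?W \<delta> else 0)"
    unfolding P using c by (subst sum.inter_filter[symmetric]) (auto intro: finite_PiE)
  also have "\<dots> = (\<Sum>(x, g)\<in>UNIV \<times> ?E. if leads_to (g(c := x)) (c # cs) s t then tile_wt h (u c) x * ?W (g(c := x)) else 0)"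
    unfolding PiE_insert_eq
    by (subst sum.reindex[OF inj_combinator[OF c]])
       (simp only: comp_def case_prod_unfold fun_upd_same)
  also have "\<dots> = (\<Sum>x\<in>UNIV. \<Sum>g\<in>?E. if leads_to (g(c := x)) (c # cs) s t then tile_wt h (u c) x * ?W (g(c := x)) else 0)"
    by (simp add: sum.cartesian_product)
  also have "\<dots> = (\<Sum>x\<in>UNIV. if ?ok x then tile_wt h (u c) x * (\<Sum>g | g \<in> ?E \<and> leads_to g cs (?s x) t. ?W g) else 0)"
  proof (rule sum.cong[OF refl])
    fix x
    have "(\<Sum>g\<in>?E. if leads_to (g(c := x)) (c # cs) s t then tile_wt h (u c) x * ?W (g(c := x)) else 0)
        = (\<Sum>g\<in>?E. if ?ok x then tile_wt h (u c) x * (if leads_to g cs (?s x) t then ?W g else 0) else 0)"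
      by (intro sum.cong refl) (simp only: W L leads_to.simps fun_upd_same split: if_split, simp)
    then show "(\<Sum>g\<in>?E. if leads_to (g(c := x)) (c # cs) s t then tile_wt h (u c) x * ?W (g(c := x)) else 0)
        = (if ?ok x then tile_wt h (u c) x * (\<Sum>g | g \<in> ?E \<and> leads_to g cs (?s x) t. ?W g) else 0)"
      by (simp add: sum.inter_filter[OF fin] sum_distrib_left)
  qed
  also have "\<dots> = (\<Sum>x\<in>UNIV. if ?ok x then tile_wt h (u c) x * cells_op h u cs (\<lambda>s. if s = t then 1 else 0) (?s x) else 0)"
    using Cons.prems by (simp only: Cons.IH distinct.simps)
  also have "\<dots> = cells_op h u (c # cs) (\<lambda>s. if s = t then 1 else 0) s"
    by (subst sum_tiles) simp
  finally show ?case .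
qed

primrec grid_cells :: "nat \<Rightarrow> nat \<Rightarrow> (nat \<times> nat) list" where
  "grid_cells n 0 = []"
| "grid_cells n (Suc m) = map (Pair (Suc m)) [1..<Suc n] @ grid_cells n m"

lemma set_grid_cells: "set (grid_cells n m) = {1..m} \<times> {1..n}"
  by (induction m) auto

lemma distinct_grid_cells: "distinct (grid_cells n m)"
  by (induction m) (auto simp: set_grid_cells distinct_map inj_on_def)

lemma cells_op_row:
  "cells_op h (\<lambda>(i, j). u i - y j) (map (Pair i) [1..<Suc m]) F = row_op h i (u i) y m F"
  by (induction m arbitrary: F) (simp_all add: cells_op_append cell_pos_def)

lemma cells_op_grid:
  "cells_op h (\<lambda>(i, j). u i - y j) (grid_cells n m) F = grid_op n h u y m F"
  by (induction m) (simp_all add: cells_op_append cells_op_row del: upt_Suc One_nat_def)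

text \<open>The labels met along the lattice path from the north-west to the south-east corner that
  separates the cells before \<open>(i, j)\<close> from the others, the cells being read row by row from the
  bottom.\<close>

definition path_state :: "nat \<Rightarrow> grid \<Rightarrow> nat \<Rightarrow> nat \<Rightarrow> nat \<Rightarrow> nat" where
  "path_state n \<delta> i j p =
     (if p < i then p
      else if p + 1 < i + j then south_label n \<delta> (i - 1) (p + 1 - i)
      else if p + 1 = i + j then west_label n \<delta> i j
      else if p \<le> i + n then south_label n \<delta> i (p - i)
      else if p \<le> 2 * n then west_label n \<delta> (p - n) (Suc n)
      else 0)"

lemma path_state_cell:
  assumes "i \<in> {1..n}" "j \<in> {1..n}"
  shows "path_state n \<delta> i j (cell_pos (i, j)) = west_label n \<delta> i j"
    and "path_state n \<delta> i j (Suc (cell_pos (i, j))) = south_label n \<delta> i j"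
  using assms by (auto simp: path_state_def cell_pos_def)

text \<open>Moving the lattice path across a cell replaces its west and south edges by its north and
  east edges, in the same two positions.\<close>

lemma path_state_step:
  assumes "i \<in> {1..n}" "j \<in> {1..n}"
  shows "path_state n \<delta> i (Suc j) =
    (if straight (\<delta> (i, j))
     then path_state n \<delta> i j \<circ> transpose (cell_pos (i, j)) (Suc (cell_pos (i, j)))
     else path_state n \<delta> i j)"
proof -
  let ?q = "cell_pos (i, j)"
  obtain k where k: "i = Suc k" "k < n" using assms(1) by (cases i) auto
  have "path_state n \<delta> i (Suc j) p = path_state n \<delta> i j p" if "p \<noteq> ?q" "p \<noteq> Suc ?q" for p
    using that assms by (auto simp: path_state_def cell_pos_def)
  moreover have "path_state n \<delta> i (Suc j) ?q =
      (if straight (\<delta> (i, j)) then south_label n \<delta> i j else west_label n \<delta> i j)"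
    using assms k by (simp add: path_state_def cell_pos_def south_label_step)
  moreover have "path_state n \<delta> i (Suc j) (Suc ?q) =
      (if straight (\<delta> (i, j)) then west_label n \<delta> i j else south_label n \<delta> i j)"
    using assms by (simp add: path_state_def cell_pos_def west_label_step)
  ultimately show ?thesis
    using path_state_cell[OF assms, of \<delta>] by (intro ext) (simp add: transpose_def)
qed

lemma path_state_next_row:
  assumes "1 \<le> i" "i < n"
  shows "path_state n \<delta> (Suc i) (Suc n) = path_state n \<delta> i 1"
  using assms by (auto simp: path_state_def fun_eq_iff)

definition start_state :: "nat \<Rightarrow> nat \<Rightarrow> nat" where
  "start_state n p = (if p \<in> {1..n} then p else 0)"

definition end_state :: "nat \<Rightarrow> (nat \<Rightarrow> nat) \<Rightarrow> nat \<Rightarrow> nat" where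
  "end_state n w p = (if p \<in> {1..n} then inv w p else 0)"

lemma path_state_start:
  assumes "1 \<le> n"
  shows "path_state n \<delta> n 1 = start_state n"
proof
  fix p
  show "path_state n \<delta> n 1 p = start_state n p"
    using assms by (auto simp: path_state_def start_state_def)
qed

lemma path_state_end:
  assumes "1 \<le> n"
  shows "path_state n \<delta> 1 (Suc n) = end_state n w \<longleftrightarrow>
    (\<forall>i\<in>{1..n}. west_label n \<delta> i (Suc n) = 0) \<and> (\<forall>j\<in>{1..n}. south_label n \<delta> 0 j = inv w j)"
    (is "?L \<longleftrightarrow> ?R")
proof
  assume L: ?L
  have "west_label n \<delta> i (Suc n) = 0" if "i \<in> {1..n}" for i
    using fun_cong[OF L, of "n + i"] that by (cases "i = 1") (auto simp: path_state_def end_state_def)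
  moreover have "south_label n \<delta> 0 j = inv w j" if "j \<in> {1..n}" for j
    using fun_cong[OF L, of j] that by (auto simp: path_state_def end_state_def)
  ultimately show ?R by blast
next
  assume R: ?R
  show ?L
  proof
    fix p
    show "path_state n \<delta> 1 (Suc n) p = end_state n w p"
    proof (cases "n < p \<and> p \<le> 2 * n")
      case True
      then have "p - n \<in> {1..n}" by auto
      with R have "west_label n \<delta> (p - n) (Suc n) = 0" by blast
      with True show ?thesis
        by (auto simp: path_state_def end_state_def)
    qed (use R assms in \<open>auto simp: path_state_def end_state_def\<close>)
  qed
qed

lemma leads_to_row:
  assumes "i \<in> {1..n}" "1 \<le> j" "j \<le> Suc n"
  shows "leads_to \<delta> (map (Pair i) [j..<Suc n] @ cs) (path_state n \<delta> i j) t \<longleftrightarrow>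
     (\<forall>j'\<in>{j..n}. fits (west_label n \<delta> i j') (south_label n \<delta> i j') (\<delta> (i, j'))) \<and>
     leads_to \<delta> cs (path_state n \<delta> i (Suc n)) t"
  using assms(3,2)
proof (induction rule: inc_induct)
  case base
  then show ?case by simp
next
  case (step j)
  then have j: "j \<in> {1..n}" "{j..n} = insert j {Suc j..n}" by auto
  have "[j..<Suc n] = j # [Suc j..<Suc n]" using j(1) by (intro upt_conv_Cons) auto
  then show ?case
    using step.IH j path_state_cell[OF assms(1) j(1), of \<delta>] path_state_step[OF assms(1) j(1), of \<delta>]
    by (auto simp del: upt_Suc)
qed

lemma leads_to_grid:
  assumes "1 \<le> m" "m \<le> n"
  shows "leads_to \<delta> (grid_cells n m) (path_state n \<delta> m 1) t \<longleftrightarrow>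
     (\<forall>i\<in>{1..m}. \<forall>j\<in>{1..n}. fits (west_label n \<delta> i j) (south_label n \<delta> i j) (\<delta> (i, j))) \<and>
     path_state n \<delta> 1 (Suc n) = t"
  using assms
proof (induction m)
  case (Suc m)
  have "{1..Suc m} = insert (Suc m) {1..m}" by auto
  moreover have "leads_to \<delta> (grid_cells n m) (path_state n \<delta> (Suc m) (Suc n)) t \<longleftrightarrow>
      (\<forall>i\<in>{1..m}. \<forall>j\<in>{1..n}. fits (west_label n \<delta> i j) (south_label n \<delta> i j) (\<delta> (i, j))) \<and>
      path_state n \<delta> 1 (Suc n) = t"
    using Suc path_state_next_row[of m n \<delta>] by (cases "m = 0") auto
  ultimately show ?case
    using leads_to_row[of "Suc m" n 1 \<delta> "grid_cells n m" t] Suc.prems by (auto simp del: upt_Suc)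
qed simp

lemma GPDs_leads_to:
  assumes "1 \<le> n" "w permutes {1..n}"
  shows "GPDs n w = {\<delta>. \<delta> \<in> set (grid_cells n n) \<rightarrow>\<^sub>E UNIV \<and>
           leads_to \<delta> (grid_cells n n) (start_state n) (end_state n w)}"
proof (rule set_eqI)
  fix \<delta>
  show "\<delta> \<in> GPDs n w \<longleftrightarrow> \<delta> \<in> {\<delta>. \<delta> \<in> set (grid_cells n n) \<rightarrow>\<^sub>E UNIV \<and>
           leads_to \<delta> (grid_cells n n) (start_state n) (end_state n w)}"
    using leads_to_grid[OF assms(1) order_refl, of \<delta> "end_state n w"] path_state_end[OF assms(1), of \<delta> w]
    unfolding GPDs_iff[OF assms(2)] path_state_start[OF assms(1)] labelled_def set_grid_cells
    by blast
qed

lemma finite_GPDs: "finite (GPDs n w)"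
proof (rule finite_subset)
  show "GPDs n w \<subseteq> ({1..n} \<times> {1..n}) \<rightarrow>\<^sub>E UNIV" by (auto simp: GPDs_def valid_filling_def)
qed (auto intro: finite_PiE)

definition gpd_sum :: "nat \<Rightarrow> 'a::comm_ring_1 \<Rightarrow> (nat \<Rightarrow> 'a) \<Rightarrow> (nat \<Rightarrow> 'a) \<Rightarrow> (nat \<Rightarrow> nat) \<Rightarrow> 'a" where
  "gpd_sum n h u y w = (\<Sum>\<delta>\<in>GPDs n w. \<Prod>(i, j)\<in>{1..n} \<times> {1..n}. tile_wt h (u i - y j) (\<delta> (i, j)))"

lemma gpd_sum_eq_grid_op:
  assumes "1 \<le> n" "w permutes {1..n}"
  shows "gpd_sum n h u y w =
    grid_op n h u y n (\<lambda>s. if s = end_state n w then 1 else 0) (start_state n)"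
  using sum_fillings[OF distinct_grid_cells, where h = h and u = "\<lambda>(i, j). u i - y j" and s = "start_state n" and t = "end_state n w"]
  unfolding gpd_sum_def GPDs_leads_to[OF assms] cells_op_grid
  by (simp add: set_grid_cells case_prod_unfold)

text \<open>The operator of the Yang--Baxter equation acts on two pipes at the western boundary and on
  two absent pipes at the eastern one.\<close>

lemma gpd_sum_exchange:
  assumes w: "w permutes {1..n}" and i: "1 \<le> i" "i < n"
  shows "(u i - u (i + 1)) * (gpd_sum n h u y (w \<circ> transpose i (i + 1)) + gpd_sum n h (u \<circ> transpose i (i + 1)) y w) =
    h * (gpd_sum n h u y w - gpd_sum n h (u \<circ> transpose i (i + 1)) y w)"
proof -
  let ?\<tau> = "transpose i (i + 1)" and ?d = "u (i + 1) - u i"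
  define F where "F = (\<lambda>v s. if s = end_state n v then 1 else 0 :: 'a)"
  have n: "1 \<le> n" using i by simp
  have \<tau>: "?\<tau> permutes {1..n}" using i by (intro permutes_swap_id) auto
  have w': "w \<circ> ?\<tau> permutes {1..n}" by (rule permutes_compose[OF \<tau> w])
  \<comment> \<open>Both positions lie beyond \<open>n\<close>, where the end state is 0. Hence the
    swap fixes it with sign -1, and the operator is multiplication by \<open>h - ?d\<close>.\<close>
  have "R_op h (i + n) ?d (F w) = (\<lambda>s. (h - ?d) * F w s)"
  proof
    fix s
    let ?t = "transpose (i + n) (Suc (i + n))"
    have "s \<circ> ?t = end_state n w \<longleftrightarrow> s = end_state n w"
    proof -
      have "end_state n w \<circ> ?t = end_state n w"
        using i by (auto simp: end_state_def fun_eq_iff transpose_def)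
      then show ?thesis by (metis comp_assoc comp_id transpose_comp_involutory)
    qed
    moreover have "end_state n w (i + n) = 0" "end_state n w (Suc (i + n)) = 0"
      using i by (auto simp: end_state_def)
    ultimately show "R_op h (i + n) ?d (F w) s = (h - ?d) * F w s"
      by (auto simp: R_op_def swap_op_def F_def algebra_simps)
  qed
  moreover have scale: "grid_op n h v y m (\<lambda>s. c * F w s) s = c * grid_op n h v y m (F w) s" for c v m s
  proof -
    have R: "R_op h p b (\<lambda>s. c * G s) = (\<lambda>s. c * R_op h p b G s)" for p b and G :: "(nat \<Rightarrow> nat) \<Rightarrow> 'a"
      by (simp add: R_op_eq swap_op_linear fun_eq_iff algebra_simps)
    have row: "row_op h p b y k (\<lambda>s. c * G s) = (\<lambda>s. c * row_op h p b y k G s)" for p b k and G :: "(nat \<Rightarrow> nat) \<Rightarrow> 'a"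
      by (induction k arbitrary: G) (simp_all add: R)
    show ?thesis
    proof (induction m arbitrary: s)
      case (Suc m)
      then have "grid_op n h v y m (\<lambda>s. c * F w s) = (\<lambda>s. c * grid_op n h v y m (F w) s)" by blast
      then show ?case by (simp add: row)
    qed simp
  qed
  moreover have G: "gpd_sum n h v y w = grid_op n h v y n (F w) (start_state n)" for v
    by (simp add: gpd_sum_eq_grid_op[OF n w] F_def)
  ultimately have ex: "R_op h i ?d (grid_op n h u y n (F w)) (start_state n) =
      (h - ?d) * gpd_sum n h (u \<circ> ?\<tau>) y w"
    using grid_op_exchange[OF i, of h u n y "F w"] by simp
  \<comment> \<open>At the west boundary the positions \<open>i\<close> and \<open>i + 1\<close>
    carry the labels \<open>i\<close> and \<open>i + 1\<close>. Both are nonzero, so no sign arises,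
    and exchanging them renames two pipes, which turns \<open>w\<close> into
    \<open>w \<circ> ?\<tau>\<close>.\<close>
  have \<tau>0: "?\<tau> a = 0 \<longleftrightarrow> a = 0" for a
    using i by (auto simp: transpose_def)
  have "start_state n \<circ> ?\<tau> = ?\<tau> \<circ> start_state n"
    using i by (auto simp: start_state_def fun_eq_iff transpose_def)
  moreover have "(\<lambda>s. F w (?\<tau> \<circ> s)) = F (w \<circ> ?\<tau>)"
  proof -
    have "inv (w \<circ> ?\<tau>) = ?\<tau> \<circ> inv w"
      using permutes_bij[OF w] by (simp add: o_inv_distrib)
    then have "?\<tau> \<circ> end_state n w = end_state n (w \<circ> ?\<tau>)"
      using i by (auto simp: end_state_def fun_eq_iff transpose_def)
    then have "?\<tau> \<circ> s = end_state n w \<longleftrightarrow> s = end_state n (w \<circ> ?\<tau>)" for s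
      by (metis comp_assoc id_comp transpose_comp_involutory)
    then show ?thesis by (simp add: F_def fun_eq_iff)
  qed
  ultimately have "swap_op i (grid_op n h u y n (F w)) (start_state n) = gpd_sum n h u y (w \<circ> ?\<tau>)"
    using i grid_op_relabel[of ?\<tau> n h u y n "F w" "start_state n", OF \<tau>0]
    unfolding gpd_sum_eq_grid_op[OF n w']
    by (simp add: swap_op_def start_state_def F_def)
  with ex have "h * gpd_sum n h u y w + ?d * gpd_sum n h u y (w \<circ> ?\<tau>) = (h - ?d) * gpd_sum n h (u \<circ> ?\<tau>) y w"
    by (simp add: R_op_def G)
  then show ?thesis by (simp add: algebra_simps)
qed

section \<open>Counting crossings and blank tiles\<close>

text \<open>The label 0 is shared by all absent pipes, so only positive labels have a well-defined
  position.\<close>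

definition has_labels :: "nat \<Rightarrow> (nat \<Rightarrow> nat) \<Rightarrow> bool" where
  "has_labels n s \<longleftrightarrow> (\<forall>k\<in>{1..n}. \<exists>!p. s p = k)"

definition position :: "(nat \<Rightarrow> nat) \<Rightarrow> nat \<Rightarrow> nat" where
  "position s k = (THE p. s p = k)"

lemma position_eq_iff:
  assumes "has_labels n s" "k \<in> {1..n}"
  shows "position s k = p \<longleftrightarrow> s p = k"
proof -
  have ex: "\<exists>!p. s p = k" using assms by (simp add: has_labels_def)
  show ?thesis
    using theI'[OF ex] the1_equality[OF ex, of p] by (auto simp: position_def)
qed

lemma has_labels_comp:
  assumes "has_labels n s" "bij \<pi>"
  shows "has_labels n (s \<circ> \<pi>)"
  unfolding has_labels_def
proof
  fix k assume "k \<in> {1..n}"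
  then obtain p where p: "s p = k" "\<And>q. s q = k \<Longrightarrow> q = p"
    using assms(1) unfolding has_labels_def by metis
  show "\<exists>!q. (s \<circ> \<pi>) q = k"
  proof (rule ex1I[of _ "inv \<pi> p"])
    show "(s \<circ> \<pi>) (inv \<pi> p) = k" using p(1) assms(2) by (simp add: bij_is_surj surj_f_inv_f)
    show "q = inv \<pi> p" if "(s \<circ> \<pi>) q = k" for q
      using p(2)[of "\<pi> q"] that assms(2) by (metis bij_inv_eq_iff comp_apply)
  qed
qed

lemma position_comp_transpose:
  assumes "has_labels n s" "k \<in> {1..n}"
  shows "position (s \<circ> transpose p q) k = transpose p q (position s k)"
proof -
  have "has_labels n (s \<circ> transpose p q)" by (rule has_labels_comp[OF assms(1)]) simp
  then show ?thesis
    using assms by (subst position_eq_iff[of n]) (auto simp flip: position_eq_iff)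
qed

lemma has_labels_path_state:
  assumes "i \<in> {1..n}" "1 \<le> j" "j \<le> Suc n"
  shows "has_labels n (path_state n \<delta> i j)"
proof -
  have row: "has_labels n (path_state n \<delta> i j)"
    if "has_labels n (path_state n \<delta> i 1)" "i \<in> {1..n}" "1 \<le> j" "j \<le> Suc n" for i j
    using that(3,4)
  proof (induction rule: dec_induct)
    case base
    then show ?case using that(1) by simp
  next
    case (step j)
    then have "j \<in> {1..n}" by auto
    from path_state_step[OF that(2) this, of \<delta>] show ?case
      using step by (auto intro: has_labels_comp)
  qed
  have "has_labels n (path_state n \<delta> i 1)" if "1 \<le> i" "i \<le> n" for i
    using that(2,1)
  proof (induction rule: inc_induct)
    case base
    have "\<exists>!p. start_state n p = k" if "k \<in> {1..n}" for k
      using that by (intro ex1I[of _ k]) (auto simp: start_state_def split: if_splits)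
    then show ?case using base by (simp only: path_state_start has_labels_def) blast
  next
    case (step i)
    then show ?case
      using row[of "Suc i" "Suc n"] path_state_next_row[of i n \<delta>] by simp
  qed
  then show ?thesis using row assms by simp
qed

lemma label_range:
  assumes "labelled n \<delta>" "i \<in> {1..n}" "j \<in> {1..n}"
  shows "west_label n \<delta> i j \<le> n" "south_label n \<delta> i j \<le> n"
proof -
  show "west_label n \<delta> i j \<le> n"
    using label_pipe_enters[OF assms, of "west_label n \<delta> i j"] pipe_enters_label
    by (cases "west_label n \<delta> i j = 0") fastforce+
  show "south_label n \<delta> i j \<le> n"
    using label_pipe_enters[OF assms, of "south_label n \<delta> i j"] pipe_enters_label
    by (cases "south_label n \<delta> i j = 0") fastforce+
qed

text \<open>Both edges lie on one lattice path, which a pipe meets only once.\<close>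

lemma west_label_neq_south_label:
  assumes "labelled n \<delta>" "i \<in> {1..n}" "j \<in> {1..n}" "west_label n \<delta> i j \<noteq> 0"
  shows "west_label n \<delta> i j \<noteq> south_label n \<delta> i j"
proof
  let ?k = "west_label n \<delta> i j" and ?s = "path_state n \<delta> i j" and ?p = "cell_pos (i, j)"
  assume eq: "?k = south_label n \<delta> i j"
  have "?k \<in> {1..n}" using assms label_range by auto
  moreover have "has_labels n ?s" using assms by (intro has_labels_path_state) auto
  ultimately have "\<exists>!p. ?s p = ?k" unfolding has_labels_def by blast
  moreover have "?s ?p = ?k" "?s (Suc ?p) = ?k" using path_state_cell[OF assms(2,3), of \<delta>] eq by simp_all
  ultimately show False by (metis n_not_Suc_n)
qed

definition crossing_cells :: "nat \<Rightarrow> grid \<Rightarrow> nat \<Rightarrow> nat \<Rightarrow> (nat \<times> nat) set" where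
  "crossing_cells n \<delta> k l = {(i, j) \<in> {1..n} \<times> {1..n}. \<delta> (i, j) = Cross \<and>
     {west_label n \<delta> i j, south_label n \<delta> i j} = {k, l}}"

lemma finite_crossing_cells [simp]: "finite (crossing_cells n \<delta> k l)"
  by (rule finite_subset[of _ "{1..n} \<times> {1..n}"]) (auto simp: crossing_cells_def)

lemma cross_at_iff:
  assumes "labelled n \<delta>" "k \<in> {1..n}" "l \<in> {1..n}"
  shows "cross_at n \<delta> k l c \<longleftrightarrow> c \<in> crossing_cells n \<delta> k l"
proof (cases c)
  case (Pair i j)
  have "pipe_enters n \<delta> a (i, j) West \<longleftrightarrow> west_label n \<delta> i j = a"
    "pipe_enters n \<delta> a (i, j) South \<longleftrightarrow> south_label n \<delta> i j = a"
    if "i \<in> {1..n}" "j \<in> {1..n}" "a \<in> {1..n}" for a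
    using label_pipe_enters[OF assms(1) that(1,2), of a] pipe_enters_label[of n \<delta> a "(i, j)"] that(3)
    by auto
  then show ?thesis
    using Pair assms by (auto simp: cross_at_def crossing_cells_def doubleton_eq_iff)
qed

text \<open>A straight tile exchanges two neighbouring entries of the path. This affects the order
  of \<open>k\<close> and \<open>l\<close> only if they are these two entries, and two positive
  labels are exchanged only by a \<open>Cross\<close>.\<close>

lemma position_less_step:
  assumes "labelled n \<delta>" "i \<in> {1..n}" "j \<in> {1..n}" "k \<in> {1..n}" "l \<in> {1..n}" "k \<noteq> l"
  shows "position (path_state n \<delta> i (Suc j)) k < position (path_state n \<delta> i (Suc j)) l \<longleftrightarrow>
    (position (path_state n \<delta> i j) k < position (path_state n \<delta> i j) l) \<noteq> ((i, j) \<in> crossing_cells n \<delta> k l)"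
proof (cases "straight (\<delta> (i, j))")
  case False
  then show ?thesis
    using path_state_step[OF assms(2,3), of \<delta>] by (auto simp: crossing_cells_def)
next
  case True
  let ?s = "path_state n \<delta> i j" and ?p = "cell_pos (i, j)"
  have s: "has_labels n ?s" using assms by (intro has_labels_path_state) auto
  note pos = position_eq_iff[OF s] and cell = path_state_cell[OF assms(2,3), of \<delta>]
  have "fits (west_label n \<delta> i j) (south_label n \<delta> i j) (\<delta> (i, j))"
    using assms by (simp add: labelled_def)
  then have "(i, j) \<in> crossing_cells n \<delta> k l \<longleftrightarrow>
      west_label n \<delta> i j = k \<and> south_label n \<delta> i j = l \<or> west_label n \<delta> i j = l \<and> south_label n \<delta> i j = k"
    using True assms by (auto simp: crossing_cells_def straight_def fits_def meets_iff doubleton_eq_iff)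
  also have "\<dots> \<longleftrightarrow> position ?s k = ?p \<and> position ?s l = Suc ?p \<or> position ?s l = ?p \<and> position ?s k = Suc ?p"
    using pos[OF assms(4)] pos[OF assms(5)] cell by auto
  finally have c: "(i, j) \<in> crossing_cells n \<delta> k l \<longleftrightarrow> \<dots>" .
  have "position ?s k \<noteq> position ?s l"
    using pos[OF assms(4)] pos[OF assms(5)] assms(6) by metis
  then show ?thesis
    unfolding c using True path_state_step[OF assms(2,3), of \<delta>] assms(4,5)
    by (auto simp: position_comp_transpose[OF s] transpose_def)
qed

lemma position_less_end:
  assumes "labelled n \<delta>" "k \<in> {1..n}" "l \<in> {1..n}" "k \<noteq> l"
  shows "position (path_state n \<delta> 1 (Suc n)) k < position (path_state n \<delta> 1 (Suc n)) l \<longleftrightarrow>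
    (k < l) \<noteq> odd (card (crossing_cells n \<delta> k l))"
proof -
  let ?X = "crossing_cells n \<delta> k l"
  let ?B = "\<lambda>i j. position (path_state n \<delta> i j) k < position (path_state n \<delta> i j) l"
  let ?f = "\<lambda>i j. if (i, j) \<in> ?X then 1 else 0 :: nat"
  have row: "?B i (Suc m) \<longleftrightarrow> ?B i 1 \<noteq> odd (\<Sum>j=1..m. ?f i j)" if "i \<in> {1..n}" "m \<le> n" for i m
    using that(2)
  proof (induction m)
    case (Suc m)
    then show ?case
      using position_less_step[OF assms(1) that(1) _ assms(2-4), of "Suc m"] by auto
  qed simp
  have grid: "?B 1 (Suc n) \<longleftrightarrow> ?B m 1 \<noteq> odd (\<Sum>i=1..m. \<Sum>j=1..n. ?f i j)" if "1 \<le> m" "m \<le> n" for m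
    using that
  proof (induction rule: dec_induct)
    case base
    then show ?case using row[of 1 n] by simp
  next
    case (step m)
    then have "?B m 1 \<longleftrightarrow> ?B (Suc m) 1 \<noteq> odd (\<Sum>j=1..n. ?f (Suc m) j)"
      using path_state_next_row[of m n \<delta>] row[of "Suc m" n] by simp
    then show ?case using step by auto
  qed
  have "(\<Sum>i=1..n. \<Sum>j=1..n. ?f i j) = (\<Sum>c\<in>{1..n} \<times> {1..n}. if c \<in> ?X then 1 else 0)"
    by (simp add: sum.cartesian_product case_prod_unfold)
  also have "\<dots> = card (({1..n} \<times> {1..n}) \<inter> ?X)"
    by (simp add: sum.If_cases)
  also have "({1..n} \<times> {1..n}) \<inter> ?X = ?X" by (auto simp: crossing_cells_def)
  finally have "(\<Sum>i=1..n. \<Sum>j=1..n. ?f i j) = card ?X" .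
  moreover have n: "1 \<le> n" using assms by auto
  have start: "has_labels n (start_state n)"
    using has_labels_path_state[of n n 1 \<delta>] n unfolding path_state_start[OF n] by simp
  have "position (start_state n) a = a" if "a \<in> {1..n}" for a
    using that by (subst position_eq_iff[OF start]) (auto simp: start_state_def)
  then have "?B n 1 \<longleftrightarrow> k < l"
    using assms(2,3) unfolding path_state_start[OF n] by simp
  ultimately show ?thesis using grid[of n] n by simp
qed

text \<open>On the final path pipe \<open>k\<close> has position \<open>w k\<close>, and every
  crossing of two pipes reverses their order, so inversions are the pairs reversed an odd number of
  times.\<close>

lemma odd_crossings_iff:
  assumes "1 \<le> n" "w permutes {1..n}" "\<delta> \<in> GPDs n w" "k \<in> {1..n}" "l \<in> {1..n}" "k < l"
  shows "odd (card (crossing_cells n \<delta> k l)) \<longleftrightarrow> w l < w k"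
proof -
  have lab: "labelled n \<delta>" using assms(3) by (simp add: GPDs_iff[OF assms(2)])
  have e: "path_state n \<delta> 1 (Suc n) = end_state n w"
    using assms(3) path_state_end[OF assms(1)] by (simp add: GPDs_iff[OF assms(2)])
  have hl: "has_labels n (end_state n w)"
    using has_labels_path_state[of 1 n "Suc n" \<delta>] assms(1) e by simp
  have "position (end_state n w) a = w a" if "a \<in> {1..n}" for a
    using that permutes_in_image[OF assms(2), of a] permutes_inverses(2)[OF assms(2)]
    by (subst position_eq_iff[OF hl]) (auto simp: end_state_def)
  moreover have "w k \<noteq> w l" using permutes_inj[OF assms(2)] assms(6) by (auto dest: injD)
  ultimately show ?thesis
    using position_less_end[OF lab assms(4,5)] assms(4-6) unfolding e by auto
qed

section \<open>Tile counts, crossings and Coxeter length\<close>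

definition tile_count :: "(tile \<Rightarrow> bool) \<Rightarrow> nat \<Rightarrow> grid \<Rightarrow> nat" where
  "tile_count T n \<delta> = card {c \<in> {1..n} \<times> {1..n}. T (\<delta> c)}"

lemma tile_count_eq_0_iff:
  "tile_count T n \<delta> = 0 \<longleftrightarrow> (\<forall>c\<in>{1..n} \<times> {1..n}. \<not> T (\<delta> c))"
  unfolding tile_count_def by (subst card_0_eq) auto

lemma tile_count_add:
  assumes "\<And>t. T t \<longleftrightarrow> T1 t \<or> T2 t" "\<And>t. \<not> (T1 t \<and> T2 t)"
  shows "tile_count T n \<delta> = tile_count T1 n \<delta> + tile_count T2 n \<delta>"
proof -
  have "{c \<in> {1..n} \<times> {1..n}. T (\<delta> c)} =
      {c \<in> {1..n} \<times> {1..n}. T1 (\<delta> c)} \<union> {c \<in> {1..n} \<times> {1..n}. T2 (\<delta> c)}"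
    using assms(1) by auto
  then show ?thesis
    unfolding tile_count_def by (simp only:) (rule card_Un_disjoint, use assms(2) in auto)
qed

definition pairs :: "nat \<Rightarrow> (nat \<times> nat) set" where
  "pairs n = {(k, l). 1 \<le> k \<and> k < l \<and> l \<le> n}"

lemma finite_pairs [simp]: "finite (pairs n)"
  by (rule finite_subset[of _ "{1..n} \<times> {1..n}"]) (auto simp: pairs_def)

lemma count_cross:
  assumes "labelled n \<delta>"
  shows "tile_count (\<lambda>t. t = Cross) n \<delta> = (\<Sum>(k, l)\<in>pairs n. card (crossing_cells n \<delta> k l))"
proof -
  let ?X = "\<lambda>(k, l). crossing_cells n \<delta> k l"
  have "{c \<in> {1..n} \<times> {1..n}. \<delta> c = Cross} = (\<Union>p\<in>pairs n. ?X p)"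
  proof (intro equalityI subsetI)
    fix c assume c: "c \<in> {c \<in> {1..n} \<times> {1..n}. \<delta> c = Cross}"
    obtain i j where ij: "c = (i, j)" "i \<in> {1..n}" "j \<in> {1..n}" using c by auto
    let ?a = "west_label n \<delta> i j" and ?b = "south_label n \<delta> i j"
    have "fits ?a ?b (\<delta> (i, j))" using assms ij by (simp add: labelled_def)
    then have "?a \<noteq> 0" "?b \<noteq> 0" using c ij by (auto simp: fits_def meets_iff)
    moreover have "?a \<le> n" "?b \<le> n" using label_range[OF assms ij(2,3)] by auto
    moreover have "?a \<noteq> ?b" using west_label_neq_south_label[OF assms ij(2,3)] \<open>?a \<noteq> 0\<close> by simp
    ultimately have "(min ?a ?b, max ?a ?b) \<in> pairs n" by (auto simp: pairs_def min_def max_def)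
    moreover have "c \<in> ?X (min ?a ?b, max ?a ?b)"
      using c ij by (auto simp: crossing_cells_def min_def max_def)
    ultimately show "c \<in> (\<Union>p\<in>pairs n. ?X p)" by blast
  qed (auto simp: crossing_cells_def)
  moreover have "\<forall>p\<in>pairs n. \<forall>q\<in>pairs n. p \<noteq> q \<longrightarrow> ?X p \<inter> ?X q = {}"
    by (auto simp: crossing_cells_def pairs_def doubleton_eq_iff)
  ultimately show ?thesis
    unfolding tile_count_def by (simp add: card_UN_disjoint case_prod_unfold)
qed

lemma no_double_crossing_iff:
  assumes "labelled n \<delta>"
  shows "no_double_crossing n \<delta> \<longleftrightarrow> (\<forall>(k, l)\<in>pairs n. card (crossing_cells n \<delta> k l) \<le> 1)"
proof -
  have sym: "crossing_cells n \<delta> k l = crossing_cells n \<delta> l k" for k l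
    by (auto simp: crossing_cells_def insert_commute)
  have "no_double_crossing n \<delta> \<longleftrightarrow> (\<forall>k\<in>{1..n}. \<forall>l\<in>{1..n}. k \<noteq> l \<longrightarrow> card (crossing_cells n \<delta> k l) \<le> 1)"
  proof -
    have "card X \<le> 1 \<longleftrightarrow> \<not> (\<exists>c d. c \<noteq> d \<and> c \<in> X \<and> d \<in> X)" if "finite X" for X :: "(nat \<times> nat) set"
      using card_le_Suc0_iff_eq[OF that] by auto
    then have "card (crossing_cells n \<delta> k l) \<le> 1 \<longleftrightarrow>
        \<not> (\<exists>c d. c \<noteq> d \<and> cross_at n \<delta> k l c \<and> cross_at n \<delta> k l d)"
      if "k \<in> {1..n}" "l \<in> {1..n}" for k l
      using cross_at_iff[OF assms that] by simp
    then show ?thesis by (simp only: no_double_crossing_def cong: ball_cong)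
  qed
  also have "\<dots> \<longleftrightarrow> (\<forall>(k, l)\<in>pairs n. card (crossing_cells n \<delta> k l) \<le> 1)"
  proof (intro iffI ballI impI)
    fix k l assume *: "\<forall>(k, l)\<in>pairs n. card (crossing_cells n \<delta> k l) \<le> 1" "k \<in> {1..n}" "l \<in> {1..n}" "k \<noteq> l"
    then have "(k, l) \<in> pairs n \<or> (l, k) \<in> pairs n" by (auto simp: pairs_def)
    then show "card (crossing_cells n \<delta> k l) \<le> 1" using *(1) sym[of k l] by fastforce
  qed (auto simp: pairs_def)
  finally show ?thesis .
qed

lemma coxeter_length_eq_sum:
  "coxeter_length n w = (\<Sum>(k, l)\<in>pairs n. if w l < w k then 1 else 0)"
proof -
  have "{(i, j). 1 \<le> i \<and> i < j \<and> j \<le> n \<and> w i > w j} = {p \<in> pairs n. w (snd p) < w (fst p)}"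
    by (auto simp: pairs_def)
  then show ?thesis by (simp add: coxeter_length_def sum.inter_filter[symmetric] case_prod_unfold)
qed

text \<open>The number of crossings of a pair of pipes is at least its residue modulo 2, which is 1
  exactly for inversions. Summed over all pairs, equality holds iff no pair crosses more than
  once.\<close>

lemma
  assumes "1 \<le> n" "w permutes {1..n}" "\<delta> \<in> GPDs n w"
  shows coxeter_length_le_crossings: "coxeter_length n w \<le> tile_count (\<lambda>t. t = Cross) n \<delta>"
    and crossings_eq_coxeter_length_iff:
      "tile_count (\<lambda>t. t = Cross) n \<delta> = coxeter_length n w \<longleftrightarrow> no_double_crossing n \<delta>"
proof -
  have lab: "labelled n \<delta>" using assms(3) by (simp add: GPDs_iff[OF assms(2)])
  let ?N = "\<lambda>(k, l). card (crossing_cells n \<delta> k l)" and ?I = "\<lambda>(k, l). if w l < w k then 1 else 0 :: nat"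
  have odd: "?I p = ?N p mod 2" if "p \<in> pairs n" for p
    using that odd_crossings_iff[OF assms, of "fst p" "snd p"]
    by (auto simp: pairs_def odd_iff_mod_2_eq_one)
  then have le: "?I p \<le> ?N p" if "p \<in> pairs n" for p
    using that by (metis mod_less_eq_dividend)
  show "coxeter_length n w \<le> tile_count (\<lambda>t. t = Cross) n \<delta>"
    unfolding coxeter_length_eq_sum count_cross[OF lab] by (intro sum_mono le)
  have "no_double_crossing n \<delta> \<longleftrightarrow> (\<forall>p\<in>pairs n. ?N p = ?I p)"
  proof -
    have "?N p \<le> 1 \<longleftrightarrow> ?N p = ?I p" if "p \<in> pairs n" for p
    proof -
      have "N \<le> 1 \<longleftrightarrow> N = N mod 2" for N :: nat by presburger
      then show ?thesis by (simp only: odd[OF that])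
    qed
    then show ?thesis unfolding no_double_crossing_iff[OF lab] by auto
  qed
  also have "\<dots> \<longleftrightarrow> tile_count (\<lambda>t. t = Cross) n \<delta> = coxeter_length n w"
    unfolding coxeter_length_eq_sum count_cross[OF lab]
  proof
    assume "\<forall>p\<in>pairs n. ?N p = ?I p"
    then show "sum ?N (pairs n) = sum ?I (pairs n)" by (intro sum.cong) auto
  next
    assume "sum ?N (pairs n) = sum ?I (pairs n)"
    then show "\<forall>p\<in>pairs n. ?N p = ?I p"
      using sum_mono_inv[of ?I "pairs n" ?N, OF _ le] by (intro ballI) (simp only: finite_pairs)
  qed
  finally show "tile_count (\<lambda>t. t = Cross) n \<delta> = coxeter_length n w \<longleftrightarrow> no_double_crossing n \<delta>" by blast
qed

text \<open>The number of pipes entering a cell, minus 1, is 1 at a \<open>Cross\<close> or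
  \<open>Bump\<close>, -1 at a \<open>Blank\<close> and 0 elsewhere. These values add up to 0
  because column \<open>j\<close> receives \<open>n + 1 - j\<close> pipes from the west and row
  \<open>i\<close> receives \<open>n - i\<close> from the south, in total one per cell.\<close>

lemma count_blank:
  assumes "w permutes {1..n}" "\<delta> \<in> GPDs n w"
  shows "tile_count (\<lambda>t. t = Blank) n \<delta> = tile_count (\<lambda>t. t = Cross) n \<delta> + tile_count (\<lambda>t. t = Bump) n \<delta>"
proof -
  have R: "labelled n \<delta>" "\<forall>i\<in>{1..n}. west_label n \<delta> i (Suc n) = 0" "\<forall>j\<in>{1..n}. south_label n \<delta> 0 j = inv w j"
    using assms(2) by (simp_all add: GPDs_iff[OF assms(1)])
  define W where "W i j = (of_bool (west_label n \<delta> i j \<noteq> 0) :: int)" for i j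
  define S where "S i j = (of_bool (south_label n \<delta> i j \<noteq> 0) :: int)" for i j
  have fit: "fits (west_label n \<delta> i j) (south_label n \<delta> i j) (\<delta> (i, j))" if "i \<in> {1..n}" "j \<in> {1..n}" for i j
    using R(1) that by (simp add: labelled_def)
  have cons: "W i j + S i j = W i (Suc j) + S (i - 1) j" if "i \<in> {1..n}" "j \<in> {1..n}" for i j
  proof -
    have "Suc (i - 1) = i" "i - 1 < n" using that by auto
    then show ?thesis
      using that by (simp add: W_def S_def west_label_step south_label_step)
  qed
  have tel: "(\<Sum>i=1..m. S (i - 1) j) + S m j = (\<Sum>i=1..m. S i j) + S 0 j" for j m
    by (induction m) auto
  have Sn: "S n j = 0" for j by (simp add: S_def)
  have W1: "W i 1 = 1" if "i \<in> {1..n}" for i using that by (simp add: W_def)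
  have Wn: "W i (Suc n) = 0" if "i \<in> {1..n}" for i using that R(2) by (simp add: W_def)
  have S0: "S 0 j = 1" if "j \<in> {1..n}" for j
    using R(3) that permutes_in_image[OF permutes_inv[OF assms(1)], of j] by (auto simp: S_def)
  \<comment> \<open>Each column releases one pipe through the north boundary and gains none from the
    south, so the eastward flux drops by one per column.\<close>
  have sum_W: "(\<Sum>i=1..n. W i (Suc m)) = int n - int m" if "m \<le> n" for m
    using that
  proof (induction m)
    case (Suc m)
    have "(\<Sum>i=1..n. W i (Suc m) + S i (Suc m)) = (\<Sum>i=1..n. W i (Suc (Suc m)) + S (i - 1) (Suc m))"
      using Suc.prems by (intro sum.cong refl cons) auto
    then have "(\<Sum>i=1..n. W i (Suc (Suc m))) = (\<Sum>i=1..n. W i (Suc m)) - S 0 (Suc m)"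
      using tel[where m = n and j = "Suc m"] Sn by (simp add: sum.distrib)
    then show ?case using Suc S0[of "Suc m"] by simp
  qed (simp add: W1[unfolded One_nat_def])
  have telW: "(\<Sum>j=1..m. W i (Suc j)) + W i 1 = (\<Sum>j=1..m. W i j) + W i (Suc m)" for i m
    by (induction m) auto
  \<comment> \<open>Likewise each row gains one pipe from the west and loses none to the
    east.\<close>
  have sum_S: "(\<Sum>j=1..n. S m j) = int n - int m" if "m \<le> n" for m
    using that
  proof (induction m)
    case 0
    then show ?case using S0 by simp
  next
    case (Suc m)
    have "(\<Sum>j=1..n. W (Suc m) j + S (Suc m) j) = (\<Sum>j=1..n. W (Suc m) (Suc j) + S m j)"
      using Suc.prems cons[of "Suc m"] by (intro sum.cong refl) auto
    then have "(\<Sum>j=1..n. S (Suc m) j) = (\<Sum>j=1..n. S m j) - 1"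
      using telW[of "Suc m" n] W1[of "Suc m"] Wn[of "Suc m"] Suc.prems by (simp add: sum.distrib)
    then show ?case using Suc by simp
  qed
  let ?C = "{1..n} \<times> {1..n}"
  have "(\<Sum>(i, j)\<in>?C. W i j) = (\<Sum>j=1..n. int n + 1 - int j)"
  proof -
    have "(\<Sum>(i, j)\<in>?C. W i j) = (\<Sum>j=1..n. \<Sum>i=1..n. W i j)"
      by (subst sum.swap) (simp add: sum.cartesian_product)
    also have "\<dots> = (\<Sum>j=1..n. int n + 1 - int j)"
    proof (rule sum.cong[OF refl])
      fix j assume "j \<in> {1..n}"
      then show "(\<Sum>i=1..n. W i j) = int n + 1 - int j" using sum_W[of "j - 1"] by (cases j) auto
    qed
    finally show ?thesis .
  qed
  moreover have "(\<Sum>(i, j)\<in>?C. S i j) = (\<Sum>i=1..n. int n - int i)"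
    using sum_S by (simp flip: sum.cartesian_product)
  ultimately have "(\<Sum>(i, j)\<in>?C. W i j + S i j - 1) = (\<Sum>i=1..n. int n + 1 - int i) + (\<Sum>i=1..n. int n - int i) - int n * int n"
    by (simp add: case_prod_unfold sum.distrib sum_subtractf)
  also have "\<dots> = (\<Sum>i=1..n. 2 * int n + 1 - 2 * int i) - int n * int n"
    by (simp add: sum.distrib[symmetric] algebra_simps)
  also have "(\<Sum>i=1..m. 2 * int n + 1 - 2 * int i) = int m * (2 * int n - int m)" for m
    by (induction m) (auto simp: algebra_simps)
  finally have 0: "(\<Sum>(i, j)\<in>?C. W i j + S i j - 1) = 0" by simp
  have count: "int (tile_count T n \<delta>) = (\<Sum>c\<in>?C. of_bool (T (\<delta> c)))" for T
    unfolding tile_count_def by (simp add: of_bool_def sum.If_cases Int_def)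
  have "int (tile_count (\<lambda>t. t = Cross) n \<delta>) + int (tile_count (\<lambda>t. t = Bump) n \<delta>) - int (tile_count (\<lambda>t. t = Blank) n \<delta>)
      = (\<Sum>c\<in>?C. of_bool (\<delta> c = Cross) + of_bool (\<delta> c = Bump) - of_bool (\<delta> c = Blank))"
    by (simp add: count sum.distrib sum_subtractf)
  also have "\<dots> = (\<Sum>(i, j)\<in>?C. W i j + S i j - 1)"
  proof (rule sum.cong[OF refl])
    fix c assume "c \<in> ?C"
    then obtain i j where c: "c = (i, j)" "i \<in> {1..n}" "j \<in> {1..n}" by auto
    show "of_bool (\<delta> c = Cross) + of_bool (\<delta> c = Bump) - of_bool (\<delta> c = Blank) = (case c of (i, j) \<Rightarrow> W i j + S i j - 1)"
      using fit[OF c(2,3)] c(1) by (cases "\<delta> (i, j)") (auto simp: fits_def meets_iff W_def S_def)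
  qed
  finally show ?thesis using 0 by linarith
qed

section \<open>Triangular fillings, the longest permutation and lengths\<close>

lemma GPDsD:
  assumes "w permutes {1..n}" "\<delta> \<in> GPDs n w"
  shows "labelled n \<delta>"
    and "\<And>i j. i \<in> {1..n} \<Longrightarrow> j \<in> {1..n} \<Longrightarrow> fits (west_label n \<delta> i j) (south_label n \<delta> i j) (\<delta> (i, j))"
    and "\<And>i. i \<in> {1..n} \<Longrightarrow> west_label n \<delta> i (Suc n) = 0"
    and "\<And>j. j \<in> {1..n} \<Longrightarrow> south_label n \<delta> 0 j = inv w j"
  using assms(2) by (simp_all add: GPDs_iff[OF assms(1)] labelled_def)

text \<open>Without \<open>Horizontal\<close> and \<open>Vertical\<close>, an empty south edge makes
  the east edge empty, and an empty west edge makes the north edge empty. Emptiness thus spreads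
  from the south boundary over the region below the antidiagonal.\<close>

lemma blank_if_no_straight_pipes:
  assumes "w permutes {1..n}" "\<delta> \<in> GPDs n w"
    and "\<And>i j. i \<in> {1..n} \<Longrightarrow> j \<in> {1..n} \<Longrightarrow> \<delta> (i, j) \<noteq> Horizontal \<and> \<delta> (i, j) \<noteq> Vertical"
    and "i \<in> {1..n}" "j \<in> {1..n}" "i + j > n + 1"
  shows "\<delta> (i, j) = Blank"
proof -
  note R = GPDsD[OF assms(1,2)]
  have "(i + j > n + 1 \<longrightarrow> west_label n \<delta> i j = 0) \<and> (i + j \<ge> n + 1 \<longrightarrow> south_label n \<delta> i j = 0)"
    using assms(4,5)
  proof (induction rule: grid_induct)
    case (cell i j)
    have "west_label n \<delta> i j = 0" if ij: "i + j > n + 1"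
    proof -
      from ij cell.hyps obtain k where k: "j = Suc k" "k \<in> {1..n}" by (cases j) auto
      then have "south_label n \<delta> i k = 0" using cell.IH(1) ij by auto
      then show ?thesis
        using R(2)[OF cell.hyps(1) k(2)] assms(3)[OF cell.hyps(1) k(2)] k
        by (cases "\<delta> (i, k)") (auto simp: west_label_step fits_def meets_iff)
    qed
    moreover have "south_label n \<delta> i j = 0" if ij: "i + j \<ge> n + 1"
    proof (cases "i = n")
      case False
      then have k: "Suc i \<in> {1..n}" "i < n" using cell.hyps by auto
      then have "west_label n \<delta> (Suc i) j = 0" using cell.IH(2) ij by auto
      then show ?thesis
        using R(2)[OF k(1) cell.hyps(2)] assms(3)[OF k(1) cell.hyps(2)] k
        by (cases "\<delta> (Suc i, j)") (auto simp: south_label_step fits_def meets_iff)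
    qed simp
    ultimately show ?case by blast
  qed
  then show ?thesis
    using R(2)[OF assms(4,5)] assms(6) by (cases "\<delta> (i, j)") (auto simp: fits_def meets_iff)
qed

text \<open>East edges of antidiagonal cells are empty, so a pipe entering such a cell from the west
  must turn north. By induction every cell above the antidiagonal then receives pipes from both
  sides.\<close>

lemma triangle_tiles:
  assumes "w permutes {1..n}" "\<delta> \<in> GPDs n w"
    and blank: "\<And>i j. i \<in> {1..n} \<Longrightarrow> j \<in> {1..n} \<Longrightarrow> i + j > n + 1 \<Longrightarrow> \<delta> (i, j) = Blank"
    and "i \<in> {1..n}" "j \<in> {1..n}"
  shows "(i + j \<le> n \<longrightarrow> \<delta> (i, j) = Bump \<or> \<delta> (i, j) = Cross) \<and> (i + j = n + 1 \<longrightarrow> \<delta> (i, j) = ElbowJ)"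
proof -
  note R = GPDsD[OF assms(1,2)]
  have E0: "west_label n \<delta> i (Suc j) = 0" if "i \<in> {1..n}" "j \<in> {1..n}" "i + j = n + 1" for i j
  proof (cases "j = n")
    case False
    then have "Suc j \<in> {1..n}" using that by auto
    then show ?thesis using R(2)[of i "Suc j"] blank[of i "Suc j"] that by (auto simp: fits_def meets_iff)
  qed (use R(3) that in auto)
  have J: "\<delta> (i, j) = ElbowJ" if "i \<in> {1..n}" "j \<in> {1..n}" "i + j = n + 1" "west_label n \<delta> i j \<noteq> 0" for i j
    using R(2)[OF that(1,2)] E0[OF that(1-3)] that
    by (cases "\<delta> (i, j)") (auto simp: fits_def meets_iff west_label_step)
  have full: "\<delta> (i, j) = Bump \<or> \<delta> (i, j) = Cross"
    if "i \<in> {1..n}" "j \<in> {1..n}" "west_label n \<delta> i j \<noteq> 0" "south_label n \<delta> i j \<noteq> 0" for i j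
    using R(2)[OF that(1,2)] that by (cases "\<delta> (i, j)") (auto simp: fits_def meets_iff)
  have "(i + j \<le> n + 1 \<longrightarrow> west_label n \<delta> i j \<noteq> 0) \<and> (i + j \<le> n \<longrightarrow> south_label n \<delta> i j \<noteq> 0)"
    using assms(4,5)
  proof (induction rule: grid_induct)
    case (cell i j)
    have "west_label n \<delta> i j \<noteq> 0" if ij: "i + j \<le> n + 1"
    proof (cases "j = 1")
      case False
      then obtain k where k: "j = Suc k" "k \<in> {1..n}" using cell.hyps by (cases j) auto
      then show ?thesis using cell.IH(1) ij by (simp add: west_label_step)
    qed (use cell.hyps in auto)
    moreover have "south_label n \<delta> i j \<noteq> 0" if ij: "i + j \<le> n"
    proof -
      have k: "Suc i \<in> {1..n}" "i < n" using ij cell.hyps by auto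
      have W: "west_label n \<delta> (Suc i) j \<noteq> 0" using cell.IH(2) k ij by auto
      show ?thesis
      proof (cases "i + j = n")
        case True
        then show ?thesis using J[OF k(1) cell.hyps(2) _ W] k W by (simp add: south_label_step)
      next
        case False
        then show ?thesis using cell.IH(2) k W ij by (simp add: south_label_step)
      qed
    qed
    ultimately show ?case by blast
  qed
  then show ?thesis using J full assms(4,5) by auto
qed

lemma blank_below_antidiagonal_iff:
  assumes "w permutes {1..n}" "\<delta> \<in> GPDs n w"
  shows "(\<forall>i\<in>{1..n}. \<forall>j\<in>{1..n}. i + j > n + 1 \<longrightarrow> \<delta> (i, j) = Blank) \<longleftrightarrow>
    tile_count (\<lambda>t. t = Horizontal \<or> t = Vertical) n \<delta> = 0" (is "?L \<longleftrightarrow> ?R")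
proof
  assume L: ?L
  have "\<delta> (i, j) \<noteq> Horizontal \<and> \<delta> (i, j) \<noteq> Vertical" if "i \<in> {1..n}" "j \<in> {1..n}" for i j
  proof -
    have "(i + j \<le> n \<longrightarrow> \<delta> (i, j) = Bump \<or> \<delta> (i, j) = Cross) \<and> (i + j = n + 1 \<longrightarrow> \<delta> (i, j) = ElbowJ)"
      by (rule triangle_tiles[OF assms _ that]) (use L in blast)
    moreover have "i + j > n + 1 \<longrightarrow> \<delta> (i, j) = Blank" using L that by blast
    moreover have "i + j \<le> n \<or> i + j = n + 1 \<or> i + j > n + 1" by linarith
    ultimately show ?thesis by auto
  qed
  then show ?R by (auto simp: tile_count_eq_0_iff)
next
  assume ?R
  then have "\<delta> (i, j) \<noteq> Horizontal \<and> \<delta> (i, j) \<noteq> Vertical" if "i \<in> {1..n}" "j \<in> {1..n}" for i j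
    using that unfolding tile_count_eq_0_iff by blast
  then show ?L by (intro ballI impI blank_if_no_straight_pipes[OF assms])
qed

text \<open>Pipes never move down, and pipe \<open>k\<close> starts in row \<open>k\<close>.\<close>

lemma label_row_le:
  assumes "labelled n \<delta>" "i \<in> {1..n}" "j \<in> {1..n}"
  shows "(west_label n \<delta> i j \<noteq> 0 \<longrightarrow> i \<le> west_label n \<delta> i j) \<and> (south_label n \<delta> i j \<noteq> 0 \<longrightarrow> i \<le> south_label n \<delta> i j)"
  using assms(2,3)
proof (induction rule: grid_induct)
  case (cell i j)
  have "west_label n \<delta> i j \<noteq> 0 \<longrightarrow> i \<le> west_label n \<delta> i j"
  proof (cases "j = 1")
    case False
    then obtain k where "j = Suc k" "1 \<le> k" using cell.hyps by (cases j) auto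
    then show ?thesis using cell.IH(1) by (simp add: west_label_step)
  qed simp
  moreover have "south_label n \<delta> i j \<noteq> 0 \<longrightarrow> i \<le> south_label n \<delta> i j"
  proof (cases "i = n")
    case False
    then have "i < n" using cell.hyps by auto
    then show ?thesis using cell.IH(2) by (auto simp: south_label_step)
  qed simp
  ultimately show ?case by blast
qed

text \<open>Pipes never move left, and pipe \<open>k\<close> leaves in column \<open>w k\<close>;
  the induction therefore runs backwards from the exits.\<close>

lemma label_column_le:
  assumes w: "w permutes {1..n}" and \<delta>: "\<delta> \<in> GPDs n w" and "i \<in> {1..n}" "j \<in> {1..n}"
  shows "(west_label n \<delta> i j \<noteq> 0 \<longrightarrow> j \<le> w (west_label n \<delta> i j)) \<and>
         (south_label n \<delta> i j \<noteq> 0 \<longrightarrow> j \<le> w (south_label n \<delta> i j))"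
  using assms(3,4)
proof (induction "i + (n - j)" arbitrary: i j rule: less_induct)
  case less
  note R = GPDsD[OF w \<delta>]
  have east: "j \<le> w (west_label n \<delta> i (Suc j))" if nz: "west_label n \<delta> i (Suc j) \<noteq> 0"
  proof -
    have "j \<noteq> n" using R(3) nz less.prems by auto
    then have "Suc j \<in> {1..n}" "i + (n - Suc j) < i + (n - j)" using less.prems by auto
    then have "Suc j \<le> w (west_label n \<delta> i (Suc j))" using less.hyps[of i "Suc j"] less.prems nz by blast
    then show ?thesis by simp
  qed
  have north: "j \<le> w (south_label n \<delta> (i - 1) j)" if nz: "south_label n \<delta> (i - 1) j \<noteq> 0"
  proof (cases "i = 1")
    case True
    then show ?thesis using R(4)[OF less.prems(2)] permutes_inverses(1)[OF w] by simp
  next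
    case False
    then have "i - 1 \<in> {1..n}" "i - 1 + (n - j) < i + (n - j)" using less.prems by auto
    then show ?thesis using less.hyps[of "i - 1" j] less.prems nz by blast
  qed
  have "west_label n \<delta> i (Suc j) = (if straight (\<delta> (i, j)) then west_label n \<delta> i j else south_label n \<delta> i j)"
    using less.prems by (simp add: west_label_step)
  moreover have "south_label n \<delta> (i - 1) j = (if straight (\<delta> (i, j)) then south_label n \<delta> i j else west_label n \<delta> i j)"
    using south_label_step[of "i - 1" n \<delta> j] less.prems by (cases i) auto
  ultimately show ?case
    using east north by (cases "straight (\<delta> (i, j))") simp_all
qed

lemma longest_perm_permutes: "longest_perm n permutes {1..n}"
proof -
  have "longest_perm n (longest_perm n i) = i" for i
    by (auto simp: longest_perm_def)
  then show ?thesis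
    unfolding permutes_def by (metis longest_perm_def)
qed

lemma longest_perm_longest_perm [simp]: "longest_perm n \<circ> longest_perm n = id"
  by (auto simp: longest_perm_def fun_eq_iff)

lemma coxeter_length_longest_perm:
  "coxeter_length n (longest_perm n) = card {(i, j) \<in> {1..n} \<times> {1..n}. i + j \<le> n}"
proof -
  have "bij_betw (\<lambda>(i, j). (i, i + j)) {(i, j) \<in> {1..n} \<times> {1..n}. i + j \<le> n}
     {(i, j). 1 \<le> i \<and> i < j \<and> j \<le> n \<and> longest_perm n i > longest_perm n j}"
    by (rule bij_betw_byWitness[where f' = "\<lambda>(i, j). (i, j - i)"]) (auto simp: longest_perm_def)
  then show ?thesis unfolding coxeter_length_def by (simp add: bij_betw_same_card)
qed

definition longest_grid :: "nat \<Rightarrow> grid" where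
  "longest_grid n = restrict (\<lambda>(i, j). if i + j \<le> n then Cross else if i + j = n + 1 then ElbowJ else Blank)
     ({1..n} \<times> {1..n})"

text \<open>Pipe \<open>k\<close> stays in rows up to \<open>k\<close> and columns up to
  \<open>n + 1 - k\<close>, so nothing lies below the antidiagonal. All crossings then lie strictly
  above it, where there are exactly as many cells as the length requires crossings.\<close>

lemma reduced_longest_perm:
  assumes "1 \<le> n" "\<delta> \<in> GPDs n (longest_perm n)" "no_double_crossing n \<delta>"
  shows "\<delta> = longest_grid n"
proof -
  note w = longest_perm_permutes[of n]
  note R = GPDsD[OF w assms(2)]
  have blank: "\<delta> (i, j) = Blank" if ij: "i \<in> {1..n}" "j \<in> {1..n}" "i + j > n + 1" for i j
  proof -
    have "west_label n \<delta> i j = 0 \<and> south_label n \<delta> i j = 0"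
      using label_row_le[OF R(1) ij(1,2)] label_column_le[OF w assms(2) ij(1,2)]
        label_range[OF R(1) ij(1,2)] ij
      by (auto simp: longest_perm_def split: if_splits)
    then show ?thesis using R(2)[OF ij(1,2)] by (cases "\<delta> (i, j)") (auto simp: fits_def meets_iff)
  qed
  note tri = triangle_tiles[OF w assms(2) blank]
  let ?T = "{(i, j) \<in> {1..n} \<times> {1..n}. i + j \<le> n}"
  let ?X = "{c \<in> {1..n} \<times> {1..n}. \<delta> c = Cross}"
  have fin: "finite ?T" by (rule finite_subset[of _ "{1..n} \<times> {1..n}"]) auto
  have "?X \<subseteq> ?T"
  proof
    fix c assume "c \<in> ?X"
    then obtain i j where c: "c = (i, j)" "i \<in> {1..n}" "j \<in> {1..n}" "\<delta> (i, j) = Cross" by auto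
    then have "\<not> i + j > n + 1" "i + j \<noteq> n + 1" using blank[of i j] tri[of i j] by auto
    then show "c \<in> ?T" using c by auto
  qed
  moreover have "card ?X = card ?T"
    using crossings_eq_coxeter_length_iff[OF assms(1) w assms(2)] assms(3)
    unfolding coxeter_length_longest_perm tile_count_def by blast
  ultimately have XT: "?X = ?T" using fin card_subset_eq by blast
  have cross: "\<delta> (i, j) = Cross" if "i \<in> {1..n}" "j \<in> {1..n}" "i + j \<le> n" for i j
  proof -
    have "(i, j) \<in> ?X" unfolding XT using that by simp
    then show ?thesis by simp
  qed
  show ?thesis
  proof
    fix c :: "nat \<times> nat"
    obtain i j where c: "c = (i, j)" by force
    show "\<delta> c = longest_grid n c"
    proof (cases "i \<in> {1..n} \<and> j \<in> {1..n}")
      case True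
      then consider "i + j \<le> n" | "i + j = n + 1" | "i + j > n + 1" by linarith
      then show ?thesis
        using True cross blank tri c by cases (auto simp: longest_grid_def)
    next
      case False
      have "\<delta> \<in> ({1..n} \<times> {1..n}) \<rightarrow>\<^sub>E UNIV" using assms(2) by (simp add: GPDs_iff[OF w])
      then show ?thesis using False c by (auto simp: longest_grid_def PiE_def extensional_def)
    qed
  qed
qed

section \<open>Lengths, descents and ascents\<close>

lemma coxeter_length_descent:
  assumes w: "w permutes {1..n}" and i: "1 \<le> i" "i < n" and d: "w (i + 1) < w i"
  shows "Suc (coxeter_length n (w \<circ> transpose i (i + 1))) = coxeter_length n w"
proof -
  let ?\<tau> = "transpose i (i + 1)"
  let ?I = "\<lambda>v. {(k, l). 1 \<le> k \<and> k < l \<and> l \<le> n \<and> v l < v k}"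
  let ?f = "\<lambda>(k, l). (?\<tau> k, ?\<tau> l)"
  have fin: "finite (?I v)" for v :: "nat \<Rightarrow> nat"
    by (rule finite_subset[of _ "{1..n} \<times> {1..n}"]) auto
  have inI: "(i, i + 1) \<in> ?I w" using i d by auto
  have less: "?\<tau> k < ?\<tau> l" if "k < l" "(k, l) \<noteq> (i, i + 1)" for k l
    using that by (auto simp: transpose_def)
  have range: "1 \<le> ?\<tau> k \<and> ?\<tau> k \<le> n" if "1 \<le> k" "k \<le> n" for k
    using that i by (auto simp: transpose_def)
  \<comment> \<open>The pair \<open>(i, i + 1)\<close> is the only one whose order the transposition
    reverses; it matches all other inversions.\<close>
  have "bij_betw ?f (?I w - {(i, i + 1)}) (?I (w \<circ> ?\<tau>))"
  proof (rule bij_betw_byWitness[where f' = ?f])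
    show "?f ` (?I w - {(i, i + 1)}) \<subseteq> ?I (w \<circ> ?\<tau>)"
    proof
      fix p assume "p \<in> ?f ` (?I w - {(i, i + 1)})"
      then obtain k l where p: "p = (?\<tau> k, ?\<tau> l)" "1 \<le> k" "k < l" "l \<le> n" "w l < w k" "(k, l) \<noteq> (i, i + 1)"
        by auto
      then show "p \<in> ?I (w \<circ> ?\<tau>)"
        using less[OF p(3,6)] range[of k] range[of l] by auto
    qed
    show "?f ` ?I (w \<circ> ?\<tau>) \<subseteq> ?I w - {(i, i + 1)}"
    proof
      fix p assume "p \<in> ?f ` ?I (w \<circ> ?\<tau>)"
      then obtain k l where p: "p = (?\<tau> k, ?\<tau> l)" "1 \<le> k" "k < l" "l \<le> n" "w (?\<tau> l) < w (?\<tau> k)" by auto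
      have "(k, l) \<noteq> (i, i + 1)" using p(5) d by auto
      then have "?\<tau> k < ?\<tau> l" by (rule less[OF p(3)])
      moreover have "(?\<tau> k, ?\<tau> l) \<noteq> (i, i + 1)"
        using p(3) by (auto simp: transpose_def split: if_splits)
      ultimately show "p \<in> ?I w - {(i, i + 1)}"
        using p range[of k] range[of l] by auto
    qed
  qed auto
  then have "card (?I (w \<circ> ?\<tau>)) = card (?I w - {(i, i + 1)})"
    by (simp add: bij_betw_same_card)
  then show ?thesis
    unfolding coxeter_length_def
    using card_Suc_Diff1[OF fin inI] by simp
qed

lemma coxeter_length_ascent:
  assumes w: "w permutes {1..n}" and i: "1 \<le> i" "i < n" and a: "w i < w (i + 1)"
  shows "coxeter_length n (w \<circ> transpose i (i + 1)) = Suc (coxeter_length n w)"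
proof -
  let ?\<tau> = "transpose i (i + 1)"
  have "?\<tau> permutes {1..n}" using i by (intro permutes_swap_id) auto
  then have "w \<circ> ?\<tau> permutes {1..n}" using w by (rule permutes_compose)
  then show ?thesis
    using coxeter_length_descent[of "w \<circ> ?\<tau>" n i] i a by (simp add: comp_assoc)
qed

lemma coxeter_length_le: "coxeter_length n w \<le> n * n"
proof -
  have "coxeter_length n w \<le> card ({1..n} \<times> {1..n})"
    unfolding coxeter_length_def by (intro card_mono) auto
  then show ?thesis by simp
qed

lemma permutation_without_descents:
  fixes n :: nat
  assumes w: "w permutes {1..n}" and asc: "\<And>i. 1 \<le> i \<Longrightarrow> i < n \<Longrightarrow> w i < w (i + 1)"
  shows "w = id"
proof -
  have im: "w i \<in> {1..n}" if "i \<in> {1..n}" for i using permutes_in_image[OF w] that by simp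
  have ge: "k \<le> w k" if "1 \<le> k" "k \<le> n" for k
    using that
  proof (induction rule: dec_induct)
    case base
    then show ?case using im[of 1] by auto
  next
    case (step k)
    then show ?case using asc[of k] by auto
  qed
  have le: "w k \<le> k" if "k \<le> n" "1 \<le> k" for k
    using that
  proof (induction rule: inc_induct)
    case base
    then show ?case using im[of n] by auto
  next
    case (step k)
    then show ?case using asc[of k] by auto
  qed
  show ?thesis
  proof
    fix k show "w k = id k"
    proof (cases "k \<in> {1..n}")
      case True
      then show ?thesis using ge[of k] le[of k] by auto
    qed (use permutes_not_in[OF w] in auto)
  qed
qed

lemma permutation_without_ascents:
  assumes w: "w permutes {1..n}" and desc: "\<And>i. 1 \<le> i \<Longrightarrow> i < n \<Longrightarrow> w (i + 1) < w i"
  shows "w = longest_perm n"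
proof -
  have "longest_perm n \<circ> w = id"
  proof (rule permutation_without_descents)
    show "longest_perm n \<circ> w permutes {1..n}"
      by (rule permutes_compose[OF w longest_perm_permutes])
    show "(longest_perm n \<circ> w) i < (longest_perm n \<circ> w) (i + 1)" if "1 \<le> i" "i < n" for i
    proof -
      have "w i \<in> {1..n}" "w (i + 1) \<in> {1..n}" using permutes_in_image[OF w] that by auto
      then show ?thesis using desc[OF that] by (auto simp: longest_perm_def)
    qed
  qed
  then have "longest_perm n \<circ> (longest_perm n \<circ> w) = longest_perm n" by simp
  then show ?thesis by (simp flip: comp_assoc)
qed

section \<open>Recognizing labels from their recursion; two pipe dreams of the identity\<close>

lemma labels_eqI:
  assumes W1: "\<And>i. i \<in> {1..n} \<Longrightarrow> W i 1 = i" and Sn: "\<And>j. j \<in> {1..n} \<Longrightarrow> S n j = 0"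
    and Wstep: "\<And>i j. i \<in> {1..n} \<Longrightarrow> j \<in> {1..n} \<Longrightarrow> W i (Suc j) = (if straight (\<delta> (i, j)) then W i j else S i j)"
    and Sstep: "\<And>i j. i < n \<Longrightarrow> j \<in> {1..n} \<Longrightarrow> S i j = (if straight (\<delta> (Suc i, j)) then S (Suc i) j else W (Suc i) j)"
  shows "\<And>i j. i \<in> {1..n} \<Longrightarrow> j \<in> {1..Suc n} \<Longrightarrow> west_label n \<delta> i j = W i j"
    and "\<And>i j. i \<le> n \<Longrightarrow> j \<in> {1..n} \<Longrightarrow> south_label n \<delta> i j = S i j"
proof -
  have cells: "west_label n \<delta> i j = W i j \<and> south_label n \<delta> i j = S i j" if "i \<in> {1..n}" "j \<in> {1..n}" for i j
    using that
  proof (induction rule: grid_induct)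
    case (cell i j)
    have "west_label n \<delta> i j = W i j"
    proof (cases "j = 1")
      case True
      then show ?thesis using W1 cell.hyps by simp
    next
      case False
      then obtain k where "j = Suc k" "k \<in> {1..n}" using cell.hyps by (cases j) auto
      then show ?thesis using cell Wstep[of i k] by (simp add: west_label_step)
    qed
    moreover have "south_label n \<delta> i j = S i j"
    proof (cases "i = n")
      case True
      then show ?thesis using Sn cell.hyps by simp
    next
      case False
      then have "i < n" using cell.hyps by auto
      then show ?thesis using cell Sstep[of i j] by (simp add: south_label_step)
    qed
    ultimately show ?case by blast
  qed
  show "west_label n \<delta> i j = W i j" if "i \<in> {1..n}" "j \<in> {1..Suc n}" for i j
  proof (cases "j = Suc n")
    case True
    have "n \<in> {1..n}" using that by auto
    then show ?thesis using True Wstep[of i n] cells[of i n] that by (simp add: west_label_step)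
  qed (use cells that in auto)
  show "south_label n \<delta> i j = S i j" if "i \<le> n" "j \<in> {1..n}" for i j
  proof (cases "i = 0")
    case True
    then show ?thesis using Sstep[of 0 j] cells[of 1 j] that by (simp add: south_label_step)
  qed (use cells that in auto)
qed

lemma identity_gpdI:
  fixes f :: grid and n :: nat
  defines "\<delta> \<equiv> restrict f ({1..n} \<times> {1..n})"
  assumes "\<And>i. i \<in> {1..n} \<Longrightarrow> W i 1 = i" "\<And>j. j \<in> {1..n} \<Longrightarrow> S n j = 0"
    and "\<And>i j. i \<in> {1..n} \<Longrightarrow> j \<in> {1..n} \<Longrightarrow> W i (Suc j) = (if straight (f (i, j)) then W i j else S i j)"
    and "\<And>i j. i < n \<Longrightarrow> j \<in> {1..n} \<Longrightarrow> S i j = (if straight (f (Suc i, j)) then S (Suc i) j else W (Suc i) j)"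
    and "\<And>i j. i \<in> {1..n} \<Longrightarrow> j \<in> {1..n} \<Longrightarrow> fits (W i j) (S i j) (f (i, j))"
    and "\<And>i. i \<in> {1..n} \<Longrightarrow> W i (Suc n) = 0" "\<And>j. j \<in> {1..n} \<Longrightarrow> S 0 j = j"
  shows "\<delta> \<in> GPDs n id"
proof -
  have "west_label n \<delta> i j = W i j" if "i \<in> {1..n}" "j \<in> {1..Suc n}" for i j
    by (rule labels_eqI(1)[where S = S]) (use assms that in \<open>auto simp: \<delta>_def\<close>)
  moreover have "south_label n \<delta> i j = S i j" if "i \<le> n" "j \<in> {1..n}" for i j
    by (rule labels_eqI(2)[where W = W]) (use assms that in \<open>auto simp: \<delta>_def\<close>)
  ultimately show ?thesis
    using assms(6-8) by (auto simp: GPDs_iff[OF permutes_id] labelled_def \<delta>_def inv_id)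
qed

lemma identity_gpd_straight_free:
  "\<exists>\<delta>\<in>GPDs n id. tile_count straight n \<delta> = 0"
proof (rule bexI)
  let ?f = "\<lambda>(i, j). if i + j \<le> n then Bump else if i + j = n + 1 then ElbowJ else Blank"
  show "restrict ?f ({1..n} \<times> {1..n}) \<in> GPDs n id"
    \<comment> \<open>Pipe \<open>k\<close> is a staircase: it enters cells with
      \<open>i + j = k + 1\<close> from the west and cells with \<open>i + j = k\<close> from the
      south.\<close>
    by (rule identity_gpdI[where W = "\<lambda>i j. if i + j \<le> n + 1 then i + j - 1 else 0"
          and S = "\<lambda>i j. if i + j \<le> n then i + j else 0"]) (auto simp: fits_def meets_iff)
  show "tile_count straight n (restrict ?f ({1..n} \<times> {1..n})) = 0"
    by (auto simp: tile_count_eq_0_iff)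
qed

lemma identity_gpd_blank_free:
  "\<exists>\<delta>\<in>GPDs n id. tile_count (\<lambda>t. t = Blank) n \<delta> = 0"
proof (rule bexI)
  let ?f = "\<lambda>(i, j). if i = j then ElbowJ else if j < i then Horizontal else Vertical"
  show "restrict ?f ({1..n} \<times> {1..n}) \<in> GPDs n id"
    \<comment> \<open>Pipe \<open>k\<close> is a hook: along row \<open>k\<close> to the diagonal,
      then up column \<open>k\<close>.\<close>
    by (rule identity_gpdI[where W = "\<lambda>i j. if j \<le> i then i else 0"
          and S = "\<lambda>i j. if i < j then j else 0"]) (auto simp: fits_def meets_iff)
  show "tile_count (\<lambda>t. t = Blank) n (restrict ?f ({1..n} \<times> {1..n})) = 0"
    by (auto simp: tile_count_eq_0_iff)
qed

lemma coxeter_length_id: "coxeter_length n id = 0"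
  by (auto simp: coxeter_length_eq_sum pairs_def intro!: sum.neutral)

section \<open>Sums over minimal fillings\<close>

definition min_GPDs :: "nat \<Rightarrow> (tile \<Rightarrow> bool) \<Rightarrow> (nat \<Rightarrow> nat) \<Rightarrow> grid set" where
  "min_GPDs n T w = {\<delta> \<in> GPDs n w. tile_count T n \<delta> = coxeter_length n w}"

text \<open>With \<open>T\<close> the class of straight tiles, respectively of blank tiles, and \<open>f\<close> their
  weight, this is the coefficient of the top power of \<open>B\<close>, respectively \<open>A\<close>.\<close>

definition lead_sum :: "nat \<Rightarrow> (tile \<Rightarrow> bool) \<Rightarrow> (nat \<times> nat \<Rightarrow> 'a::comm_ring_1) \<Rightarrow> (nat \<Rightarrow> nat) \<Rightarrow> 'a" where
  "lead_sum n T f w = (\<Sum>\<delta>\<in>min_GPDs n T w. \<Prod>c\<in>{1..n} \<times> {1..n}. if T (\<delta> c) then f c else 1)"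

lemma finite_min_GPDs [simp]: "finite (min_GPDs n T w)"
  using finite_GPDs by (auto simp: min_GPDs_def)

lemma lead_sum_cong:
  assumes "\<And>c. c \<in> {1..n} \<times> {1..n} \<Longrightarrow> f c = g c"
  shows "lead_sum n T f w = lead_sum n T g w"
  unfolding lead_sum_def by (intro sum.cong prod.cong refl) (use assms in auto)

definition length_bounds :: "nat \<Rightarrow> (tile \<Rightarrow> bool) \<Rightarrow> bool" where
  "length_bounds n T \<longleftrightarrow> (\<forall>w \<delta>. w permutes {1..n} \<longrightarrow> \<delta> \<in> GPDs n w \<longrightarrow> coxeter_length n w \<le> tile_count T n \<delta>)"

lemma count_straight:
  "tile_count straight n \<delta> = tile_count (\<lambda>t. t = Cross) n \<delta> + tile_count (\<lambda>t. t = Horizontal \<or> t = Vertical) n \<delta>"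
  by (rule tile_count_add) (auto simp: straight_def)

lemma length_bounds_straight:
  assumes "1 \<le> n"
  shows "length_bounds n straight"
  using coxeter_length_le_crossings[OF assms] by (auto simp: length_bounds_def count_straight intro: trans_le_add1)

lemma length_bounds_blank:
  assumes "1 \<le> n"
  shows "length_bounds n (\<lambda>t. t = Blank)"
  using coxeter_length_le_crossings[OF assms] by (auto simp: length_bounds_def count_blank intro: trans_le_add1)

lemma min_GPDs_straight:
  assumes "1 \<le> n" "w permutes {1..n}"
  shows "min_GPDs n straight w = {\<delta> \<in> GPDs n w.
    (\<forall>i\<in>{1..n}. \<forall>j\<in>{1..n}. i + j > n + 1 \<longrightarrow> \<delta> (i, j) = Blank) \<and> no_double_crossing n \<delta>}"
proof -
  have "tile_count straight n \<delta> = coxeter_length n w \<longleftrightarrow>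
      (\<forall>i\<in>{1..n}. \<forall>j\<in>{1..n}. i + j > n + 1 \<longrightarrow> \<delta> (i, j) = Blank) \<and> no_double_crossing n \<delta>"
    if "\<delta> \<in> GPDs n w" for \<delta>
    using coxeter_length_le_crossings[OF assms that] crossings_eq_coxeter_length_iff[OF assms that]
    unfolding blank_below_antidiagonal_iff[OF assms(2) that] count_straight by linarith
  then show ?thesis by (auto simp: min_GPDs_def)
qed

lemma min_GPDs_blank:
  assumes "1 \<le> n" "w permutes {1..n}"
  shows "min_GPDs n (\<lambda>t. t = Blank) w = {\<delta> \<in> GPDs n w.
    (\<forall>i\<in>{1..n}. \<forall>j\<in>{1..n}. \<delta> (i, j) \<noteq> Bump) \<and> no_double_crossing n \<delta>}"
proof -
  have "tile_count (\<lambda>t. t = Blank) n \<delta> = coxeter_length n w \<longleftrightarrow>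
      (\<forall>i\<in>{1..n}. \<forall>j\<in>{1..n}. \<delta> (i, j) \<noteq> Bump) \<and> no_double_crossing n \<delta>"
    if "\<delta> \<in> GPDs n w" for \<delta>
  proof -
    have "(\<forall>i\<in>{1..n}. \<forall>j\<in>{1..n}. \<delta> (i, j) \<noteq> Bump) \<longleftrightarrow> tile_count (\<lambda>t. t = Bump) n \<delta> = 0"
      by (auto simp: tile_count_eq_0_iff)
    then show ?thesis
      using coxeter_length_le_crossings[OF assms that] crossings_eq_coxeter_length_iff[OF assms that]
        count_blank[OF assms(2) that] by linarith
  qed
  then show ?thesis by (auto simp: min_GPDs_def)
qed

section \<open>Top coefficients in \<open>h\<close> and the exchange relation in top degree\<close>

lemma coeff_prod_monic:
  fixes F :: "'c \<Rightarrow> 'a::comm_ring_1 poly"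
  assumes "finite S" "\<And>c. c \<in> S \<Longrightarrow> F c = (if P c then [:a c:] else [:b c, 1:])"
  shows "(\<forall>k > card {c \<in> S. \<not> P c}. coeff (\<Prod>c\<in>S. F c) k = 0) \<and>
    coeff (\<Prod>c\<in>S. F c) (card {c \<in> S. \<not> P c}) = (\<Prod>c\<in>S. if P c then a c else 1)"
  using assms
proof (induction S rule: finite_induct)
  case (insert c S)
  let ?m = "card {c \<in> S. \<not> P c}" and ?p = "\<Prod>c\<in>S. F c"
  have IH: "\<forall>k > ?m. coeff ?p k = 0" "coeff ?p ?m = (\<Prod>c\<in>S. if P c then a c else 1)"
    using insert by auto
  show ?case
  proof (cases "P c")
    case True
    then have "{d \<in> insert c S. \<not> P d} = {d \<in> S. \<not> P d}" by auto
    with True show ?thesis using IH insert by simp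
  next
    case False
    then have "{d \<in> insert c S. \<not> P d} = insert c {d \<in> S. \<not> P d}" by auto
    then have card: "card {d \<in> insert c S. \<not> P d} = Suc ?m" using insert by simp
    have "(\<Prod>c\<in>insert c S. F c) = smult (b c) ?p + pCons 0 ?p"
      using insert False by simp
    then show ?thesis
      unfolding card using IH insert.hyps False by (auto simp: coeff_pCons split: nat.split)
  qed
qed simp

lemma tile_count_complement: "card {c \<in> {1..n} \<times> {1..n}. \<not> T (\<delta> c)} = n * n - tile_count T n \<delta>"
proof -
  have "{c \<in> {1..n} \<times> {1..n}. \<not> T (\<delta> c)} = {1..n} \<times> {1..n} - {c \<in> {1..n} \<times> {1..n}. T (\<delta> c)}" by auto
  then show ?thesis unfolding tile_count_def by (simp add: card_Diff_subset)
qed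

lemma tile_count_le: "tile_count T n \<delta> \<le> n * n"
proof -
  have "tile_count T n \<delta> \<le> card ({1..n} \<times> {1..n})"
    unfolding tile_count_def by (intro card_mono) auto
  then show ?thesis by simp
qed

text \<open>\<open>U\<close> states how a row parameter depends on the indeterminate
  \<open>h\<close>. Tiles in \<open>T\<close> contribute constants and all others monic linear
  factors with constant term given by \<open>g\<close>, so the degree of a filling counts the tiles
  outside \<open>T\<close>.\<close>

lemma coeff_gpd_sum:
  fixes U :: "'a::comm_ring_1 \<Rightarrow> 'a poly"
  assumes "w permutes {1..n}" "length_bounds n T"
    and wt: "\<And>a b t. tile_wt [:0, 1:] (U a - [:b:]) t = (if T t then [:f a b:] else [:g t a b, 1:])"
  shows "k > n * n - coxeter_length n w \<Longrightarrow> coeff (gpd_sum n [:0, 1:] (U \<circ> x) (\<lambda>j. [:y j:]) w) k = 0"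
    and "coeff (gpd_sum n [:0, 1:] (U \<circ> x) (\<lambda>j. [:y j:]) w) (n * n - coxeter_length n w) =
      lead_sum n T (\<lambda>(i, j). f (x i) (y j)) w"
proof -
  let ?C = "{1..n} \<times> {1..n}"
  let ?F = "\<lambda>\<delta> (i, j). tile_wt [:0, 1:] ((U \<circ> x) i - [:y j:]) (\<delta> (i, j))"
  have *: "(\<forall>k > n * n - tile_count T n \<delta>. coeff (\<Prod>c\<in>?C. ?F \<delta> c) k = 0) \<and>
      coeff (\<Prod>c\<in>?C. ?F \<delta> c) (n * n - tile_count T n \<delta>) =
        (\<Prod>c\<in>?C. if T (\<delta> c) then (\<lambda>(i, j). f (x i) (y j)) c else 1)" for \<delta>
    unfolding tile_count_complement[symmetric]
    by (rule coeff_prod_monic[where b = "\<lambda>(i, j). g (\<delta> (i, j)) (x i) (y j)"]) (auto simp: wt)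
  have le: "coxeter_length n w \<le> tile_count T n \<delta>" if "\<delta> \<in> GPDs n w" for \<delta>
    using assms(1,2) that by (auto simp: length_bounds_def)
  show "coeff (gpd_sum n [:0, 1:] (U \<circ> x) (\<lambda>j. [:y j:]) w) k = 0" if "k > n * n - coxeter_length n w"
    unfolding gpd_sum_def coeff_sum
  proof (rule sum.neutral, rule ballI)
    fix \<delta> assume "\<delta> \<in> GPDs n w"
    then have "k > n * n - tile_count T n \<delta>" using le[of \<delta>] that by linarith
    then show "coeff (\<Prod>c\<in>?C. ?F \<delta> c) k = 0" using * by blast
  qed
  have "coeff (gpd_sum n [:0, 1:] (U \<circ> x) (\<lambda>j. [:y j:]) w) (n * n - coxeter_length n w) =
      (\<Sum>\<delta>\<in>GPDs n w. if tile_count T n \<delta> = coxeter_length n w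
        then \<Prod>c\<in>?C. if T (\<delta> c) then (\<lambda>(i, j). f (x i) (y j)) c else 1 else 0)"
    unfolding gpd_sum_def coeff_sum
  proof (rule sum.cong[OF refl])
    fix \<delta> assume \<delta>: "\<delta> \<in> GPDs n w"
    show "coeff (\<Prod>c\<in>?C. ?F \<delta> c) (n * n - coxeter_length n w) =
      (if tile_count T n \<delta> = coxeter_length n w
        then \<Prod>c\<in>?C. if T (\<delta> c) then (\<lambda>(i, j). f (x i) (y j)) c else 1 else 0)"
    proof (cases "tile_count T n \<delta> = coxeter_length n w")
      case True
      then show ?thesis using *[of \<delta>] by (simp only: if_True refl)
    next
      case False
      then have "n * n - tile_count T n \<delta> < n * n - coxeter_length n w"
        using le[OF \<delta>] tile_count_le[of T n \<delta>] by linarith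
      then show ?thesis using * False by (simp only: if_False)
    qed
  qed
  then show "coeff (gpd_sum n [:0, 1:] (U \<circ> x) (\<lambda>j. [:y j:]) w) (n * n - coxeter_length n w) =
      lead_sum n T (\<lambda>(i, j). f (x i) (y j)) w"
    unfolding lead_sum_def min_GPDs_def by (simp only: sum.inter_filter[OF finite_GPDs])
qed

text \<open>Compare coefficients at \<open>Suc D\<close>. Since
  \<open>w \<circ> transpose i (i + 1)\<close> is shorter than \<open>w\<close> by one, its top
  degree is \<open>Suc D\<close>; the second summand on the left has degree at most \<open>D\<close>
  and drops out.\<close>

lemma lead_sum_exchange:
  fixes U :: "'a::comm_ring_1 \<Rightarrow> 'a poly"
  assumes w: "w permutes {1..n}" and i: "1 \<le> i" "i < n" and d: "w (i + 1) < w i"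
    and b: "length_bounds n T"
    and wt: "\<And>a b t. tile_wt [:0, 1:] (U a - [:b:]) t = (if T t then [:f a b:] else [:g t a b, 1:])"
    and U: "\<And>a b. U a - U b = [:a - b:]"
  shows "(x i - x (i + 1)) * lead_sum n T (\<lambda>(i, j). f (x i) (y j)) (w \<circ> transpose i (i + 1)) =
    lead_sum n T (\<lambda>(i, j). f (x i) (y j)) w -
    lead_sum n T (\<lambda>(k, j). f ((x \<circ> transpose i (i + 1)) k) (y j)) w"
proof -
  let ?\<tau> = "transpose i (i + 1)"
  let ?G = "\<lambda>x w. gpd_sum n [:0, 1:] (U \<circ> x) (\<lambda>j. [:y j:]) w"
  define D where "D = n * n - coxeter_length n w"
  have w': "w \<circ> ?\<tau> permutes {1..n}"
    using i by (intro permutes_compose[OF _ w] permutes_swap_id) auto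
  have D: "n * n - coxeter_length n (w \<circ> ?\<tau>) = Suc D"
    using coxeter_length_descent[OF w i d] coxeter_length_le[of n w] unfolding D_def by linarith
  have "[:x i - x (i + 1):] * (?G x (w \<circ> ?\<tau>) + ?G (x \<circ> ?\<tau>) w) = [:0, 1:] * (?G x w - ?G (x \<circ> ?\<tau>) w)"
    using gpd_sum_exchange[OF w i, of "U \<circ> x" "[:0, 1:]" "\<lambda>j. [:y j:]"] U by (simp add: comp_assoc)
  then have "coeff ([:x i - x (i + 1):] * (?G x (w \<circ> ?\<tau>) + ?G (x \<circ> ?\<tau>) w)) (Suc D) =
      coeff ([:0, 1:] * (?G x w - ?G (x \<circ> ?\<tau>) w)) (Suc D)" by simp
  then have "(x i - x (i + 1)) * (coeff (?G x (w \<circ> ?\<tau>)) (Suc D) + coeff (?G (x \<circ> ?\<tau>) w) (Suc D)) =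
      coeff (?G x w) D - coeff (?G (x \<circ> ?\<tau>) w) D" by simp
  moreover have "coeff (?G x (w \<circ> ?\<tau>)) (Suc D) = lead_sum n T (\<lambda>(i, j). f (x i) (y j)) (w \<circ> ?\<tau>)"
    using coeff_gpd_sum(2)[OF w' b wt] unfolding D .
  moreover have "coeff (?G (x \<circ> ?\<tau>) w) (Suc D) = 0"
    by (rule coeff_gpd_sum(1)[OF w b wt]) (simp add: D_def)
  moreover have "coeff (?G z w) D = lead_sum n T (\<lambda>(i, j). f (z i) (y j)) w" for z
    using coeff_gpd_sum(2)[OF w b wt] unfolding D_def .
  ultimately show ?thesis by simp
qed

lemma lead_sum_straight_exchange:
  fixes x y :: "nat \<Rightarrow> 'a::comm_ring_1"
  assumes "w permutes {1..n}" "1 \<le> i" "i < n" "w (i + 1) < w i"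
  shows "(x i - x (i + 1)) * lead_sum n straight (\<lambda>(i, j). x i - y j) (w \<circ> transpose i (i + 1)) =
    lead_sum n straight (\<lambda>(i, j). x i - y j) w -
    lead_sum n straight (\<lambda>(k, j). (x \<circ> transpose i (i + 1)) k - y j) w"
proof (rule lead_sum_exchange[OF assms, where U = "\<lambda>a. [:a:]" and g = "\<lambda>t a b. if t = Blank then b - a else 0"])
  show "length_bounds n straight" using assms by (intro length_bounds_straight) auto
  show "tile_wt [:0, 1:] ([:a:] - [:b:]) t = (if straight t then [:a - b:] else [:if t = Blank then b - a else 0, 1:])"
    for a b :: 'a and t
    by (cases t) auto
qed simp

lemma lead_sum_blank_exchange:
  fixes x y :: "nat \<Rightarrow> 'a::comm_ring_1"
  assumes "w permutes {1..n}" "1 \<le> i" "i < n" "w (i + 1) < w i"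
  shows "(x i - x (i + 1)) * lead_sum n (\<lambda>t. t = Blank) (\<lambda>(i, j). y j - x i) (w \<circ> transpose i (i + 1)) =
    lead_sum n (\<lambda>t. t = Blank) (\<lambda>(i, j). y j - x i) w -
    lead_sum n (\<lambda>t. t = Blank) (\<lambda>(k, j). y j - (x \<circ> transpose i (i + 1)) k) w"
proof (rule lead_sum_exchange[OF assms, where U = "\<lambda>a. [:a, 1:]" and g = "\<lambda>t a b. if straight t then a - b else 0"
      and f = "\<lambda>a b. b - a"])
  show "length_bounds n (\<lambda>t. t = Blank)" using assms by (intro length_bounds_blank) auto
  show "tile_wt [:0, 1:] ([:a, 1:] - [:b:]) t = (if t = Blank then [:b - a:] else [:if straight t then a - b else 0, 1:])"
    for a b :: 'a and t
    by (cases t) auto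
qed simp

section \<open>Existence of minimal pipe dreams\<close>

lemma lead_sum_nonzero_iff:
  fixes f :: "nat \<times> nat \<Rightarrow> int"
  assumes "\<And>c. c \<in> {1..n} \<times> {1..n} \<Longrightarrow> f c > 0"
  shows "lead_sum n T f w \<noteq> 0 \<longleftrightarrow> min_GPDs n T w \<noteq> {}"
proof -
  have "(\<Prod>c\<in>{1..n} \<times> {1..n}. if T (\<delta> c) then f c else 1) > 0" for \<delta> :: grid
    using assms by (intro prod_pos) auto
  then have "lead_sum n T f w > 0" if "min_GPDs n T w \<noteq> {}"
    using that unfolding lead_sum_def by (intro sum_pos) auto
  moreover have "lead_sum n T f w = 0" if "min_GPDs n T w = {}"
    using that by (simp add: lead_sum_def)
  ultimately show ?thesis by force
qed

text \<open>Induction on the length along descents, with the identity as base case. \<open>f\<close>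
  and \<open>b\<close> choose integer weights that are positive on all cells, so that nonempty sums
  do not vanish.\<close>

lemma min_GPDs_nonempty:
  fixes f :: "int \<Rightarrow> int \<Rightarrow> int"
  assumes w: "w permutes {1..n}"
    and id: "\<exists>\<delta>\<in>GPDs n id. tile_count T n \<delta> = 0"
    and pos: "\<And>i. i \<in> {1..n} \<Longrightarrow> f (int i) b > 0"
    and ex: "\<And>w i x. w permutes {1..n} \<Longrightarrow> 1 \<le> i \<Longrightarrow> i < n \<Longrightarrow> w (i + 1) < w i \<Longrightarrow>
      (x i - x (i + 1)) * lead_sum n T (\<lambda>(i, j). f (x i) b) (w \<circ> transpose i (i + 1)) =
      lead_sum n T (\<lambda>(i, j). f (x i) b) w - lead_sum n T (\<lambda>(k, j). f ((x \<circ> transpose i (i + 1)) k) b) w"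
  shows "min_GPDs n T w \<noteq> {}"
  using w
proof (induction "coxeter_length n w" arbitrary: w rule: less_induct)
  case less
  show ?case
  proof (cases "\<exists>i. 1 \<le> i \<and> i < n \<and> w (i + 1) < w i")
    case True
    then obtain i where i: "1 \<le> i" "i < n" and d: "w (i + 1) < w i" by blast
    let ?v = "w \<circ> transpose i (i + 1)"
    have "?v permutes {1..n}"
      using i by (intro permutes_compose[OF _ less.prems] permutes_swap_id) auto
    moreover have "coxeter_length n ?v < coxeter_length n w"
      using coxeter_length_descent[OF less.prems i d] by simp
    ultimately have "min_GPDs n T ?v \<noteq> {}" using less.hyps by blast
    then have "lead_sum n T (\<lambda>(i, j). f (int i) b) ?v \<noteq> 0"
      using pos by (subst lead_sum_nonzero_iff) auto
    \<comment> \<open>For \<open>x = int\<close> the factor on the left is -1. If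
      \<open>min_GPDs n T w\<close> were empty, both sums on the right would vanish, but the left
      side does not.\<close>
    then show ?thesis
      using ex[OF less.prems i d, of int] by (auto simp: lead_sum_def)
  next
    case False
    have "w i < w (i + 1)" if "1 \<le> i" "i < n" for i
    proof -
      have "w i \<noteq> w (i + 1)" using permutes_inj[OF less.prems] injD[of w i "i + 1"] by auto
      then show ?thesis using False that by (meson linorder_neqE_nat)
    qed
    then have "w = id" by (rule permutation_without_descents[OF less.prems])
    then show ?thesis using id coxeter_length_id by (auto simp: min_GPDs_def)
  qed
qed

lemma min_GPDs_straight_nonempty:
  assumes "w permutes {1..n}"
  shows "min_GPDs n straight w \<noteq> {}"
  by (rule min_GPDs_nonempty[OF assms identity_gpd_straight_free, where f = "\<lambda>a b. a - b" and b = 0])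
     (use lead_sum_straight_exchange[where y = "\<lambda>_. 0"] in auto)

lemma min_GPDs_blank_nonempty:
  assumes "w permutes {1..n}"
  shows "min_GPDs n (\<lambda>t. t = Blank) w \<noteq> {}"
  \<comment> \<open>The value \<open>n + 1\<close> for all \<open>y\<close> exceeds every row
    parameter \<open>i\<close>, so the blank weights are positive.\<close>
  by (rule min_GPDs_nonempty[OF assms identity_gpd_blank_free, where f = "\<lambda>a b. b - a" and b = "int n + 1"])
     (use lead_sum_blank_exchange[where y = "\<lambda>_. int n + 1"] in auto)

text \<open>Reducedness leaves one candidate. That it really is a pipe dream of
  \<open>longest_perm n\<close> follows from nonemptiness rather than from tracing its
  pipes.\<close>

lemma min_GPDs_longest_perm:
  assumes "1 \<le> n"
  shows "min_GPDs n straight (longest_perm n) = {longest_grid n}"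
    and "min_GPDs n (\<lambda>t. t = Blank) (longest_perm n) = {longest_grid n}"
proof -
  note w = longest_perm_permutes[of n]
  have "min_GPDs n straight (longest_perm n) \<subseteq> {longest_grid n}"
    unfolding min_GPDs_straight[OF assms w] using reduced_longest_perm[OF assms] by blast
  then show "min_GPDs n straight (longest_perm n) = {longest_grid n}"
    using min_GPDs_straight_nonempty[OF w] by blast
  have "min_GPDs n (\<lambda>t. t = Blank) (longest_perm n) \<subseteq> {longest_grid n}"
    unfolding min_GPDs_blank[OF assms w] using reduced_longest_perm[OF assms] by blast
  then show "min_GPDs n (\<lambda>t. t = Blank) (longest_perm n) = {longest_grid n}"
    using min_GPDs_blank_nonempty[OF w] by blast
qed

lemma lead_sum_longest_perm:
  assumes "1 \<le> n"
  shows "lead_sum n straight f (longest_perm n) = (\<Prod>c\<in>{(i, j). i \<in> {1..n} \<and> j \<in> {1..n} \<and> i + j \<le> n}. f c)"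
    and "lead_sum n (\<lambda>t. t = Blank) f (longest_perm n) =
      (\<Prod>(i, j)\<in>{(i, j). i \<in> {1..n} \<and> j \<in> {1..n} \<and> i + j \<le> n}. f (n + 1 - i, n + 1 - j))"
proof -
  let ?C = "{1..n} \<times> {1..n}" and ?T = "{(i, j). i \<in> {1..n} \<and> j \<in> {1..n} \<and> i + j \<le> n}"
  have "lead_sum n straight f (longest_perm n) = (\<Prod>c\<in>?C. if straight (longest_grid n c) then f c else 1)"
    by (simp add: lead_sum_def min_GPDs_longest_perm[OF assms])
  also have "\<dots> = (\<Prod>c\<in>{c \<in> ?C. straight (longest_grid n c)}. f c)"
    by (simp add: prod.inter_filter)
  also have "{c \<in> ?C. straight (longest_grid n c)} = ?T"
    by (auto simp: longest_grid_def split: if_splits)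
  finally show "lead_sum n straight f (longest_perm n) = (\<Prod>c\<in>?T. f c)" .
  have "lead_sum n (\<lambda>t. t = Blank) f (longest_perm n) = (\<Prod>c\<in>?C. if longest_grid n c = Blank then f c else 1)"
    by (simp add: lead_sum_def min_GPDs_longest_perm[OF assms])
  also have "\<dots> = (\<Prod>c\<in>{c \<in> ?C. longest_grid n c = Blank}. f c)"
    by (simp add: prod.inter_filter)
  \<comment> \<open>The half turn of the grid exchanges the cells below the antidiagonal with those
    above it.\<close>
  also have "\<dots> = (\<Prod>c\<in>?T. f (n + 1 - fst c, n + 1 - snd c))"
    by (rule prod.reindex_bij_witness[where i = "\<lambda>c. (n + 1 - fst c, n + 1 - snd c)" and j = "\<lambda>c. (n + 1 - fst c, n + 1 - snd c)"])
       (auto simp: longest_grid_def split: if_splits)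
  finally show "lead_sum n (\<lambda>t. t = Blank) f (longest_perm n) = (\<Prod>(i, j)\<in>?T. f (n + 1 - i, n + 1 - j))"
    by (simp add: case_prod_unfold)
qed

section \<open>Double Schubert polynomials and leading forms\<close>

text \<open>An arbitrary linear order on the variables makes the polynomial ring an integral domain.\<close>

fun var_code :: "var \<Rightarrow> nat" where
  "var_code A_var = 0"
| "var_code B_var = 1"
| "var_code (X_var i) = 2 * i + 2"
| "var_code (Y_var i) = 2 * i + 3"

lemma inj_var_code: "var_code u = var_code v \<Longrightarrow> u = v"
  by (cases u; cases v) (simp_all, presburger+)

instantiation var :: linorder
begin

definition less_eq_var :: "var \<Rightarrow> var \<Rightarrow> bool" where
  "less_eq_var u v \<longleftrightarrow> var_code u \<le> var_code v"

definition less_var :: "var \<Rightarrow> var \<Rightarrow> bool" where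
  "less_var u v \<longleftrightarrow> var_code u < var_code v"

instance
  by standard (auto simp: less_eq_var_def less_var_def dest: inj_var_code)

end

section \<open>Substitution as a ring homomorphism\<close>

abbreviation eval_mono :: "(var \<Rightarrow> pol) \<Rightarrow> mono \<Rightarrow> pol" where
  "eval_mono \<sigma> m \<equiv> (\<Prod>v\<in>Poly_Mapping.keys m. \<sigma> v ^ Poly_Mapping.lookup m v)"

lemma subst_superset:
  assumes "finite K" "Poly_Mapping.keys p \<subseteq> K"
  shows "subst \<sigma> p = (\<Sum>m\<in>K. of_int (Poly_Mapping.lookup p m) * eval_mono \<sigma> m)"
  unfolding subst_def using assms
  by (intro sum.mono_neutral_left) (auto simp: in_keys_iff)

lemma eval_mono_superset:
  assumes "finite K" "Poly_Mapping.keys m \<subseteq> K"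
  shows "eval_mono \<sigma> m = (\<Prod>v\<in>K. \<sigma> v ^ Poly_Mapping.lookup m v)"
  using assms by (intro prod.mono_neutral_left) (auto simp: in_keys_iff)

lemma eval_mono_add: "eval_mono \<sigma> (a + b) = eval_mono \<sigma> a * eval_mono \<sigma> b"
proof -
  let ?K = "Poly_Mapping.keys a \<union> Poly_Mapping.keys b"
  have "eval_mono \<sigma> (a + b) = (\<Prod>v\<in>?K. \<sigma> v ^ Poly_Mapping.lookup (a + b) v)"
    by (intro eval_mono_superset keys_add) auto
  also have "\<dots> = (\<Prod>v\<in>?K. \<sigma> v ^ Poly_Mapping.lookup a v) * (\<Prod>v\<in>?K. \<sigma> v ^ Poly_Mapping.lookup b v)"
    by (simp add: lookup_add power_add prod.distrib)
  also have "\<dots> = eval_mono \<sigma> a * eval_mono \<sigma> b"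
    by (subst (1 2) eval_mono_superset[of ?K]) auto
  finally show ?thesis .
qed

lemma subst_0 [simp]: "subst \<sigma> 0 = 0"
  by (simp add: subst_def)

lemma subst_diff [simp]: "subst \<sigma> (p - q) = subst \<sigma> p - subst \<sigma> q"
proof -
  let ?K = "Poly_Mapping.keys p \<union> Poly_Mapping.keys q"
  have "subst \<sigma> (p - q) = (\<Sum>m\<in>?K. of_int (Poly_Mapping.lookup (p - q) m) * eval_mono \<sigma> m)"
    by (intro subst_superset keys_diff) auto
  also have "\<dots> = (\<Sum>m\<in>?K. of_int (Poly_Mapping.lookup p m) * eval_mono \<sigma> m) -
      (\<Sum>m\<in>?K. of_int (Poly_Mapping.lookup q m) * eval_mono \<sigma> m)"
    by (simp add: lookup_minus algebra_simps sum_subtractf)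
  also have "\<dots> = subst \<sigma> p - subst \<sigma> q"
    by (simp add: subst_superset[of ?K])
  finally show ?thesis .
qed

lemma subst_uminus [simp]: "subst \<sigma> (- p) = - subst \<sigma> p"
  using subst_diff[of \<sigma> 0 p] by simp

lemma subst_add [simp]: "subst \<sigma> (p + q) = subst \<sigma> p + subst \<sigma> q"
  using subst_diff[of \<sigma> p "- q"] by simp

lemma subst_monomial: "subst \<sigma> (frag_of m) = eval_mono \<sigma> m"
  by (simp add: subst_def)

text \<open>Polynomials form the free abelian group on the monomials, so
  \<open>frag_induction\<close> in each factor reduces the claim to
  \<open>eval_mono_add\<close>.\<close>

lemma subst_mult [simp]: "subst \<sigma> (p * q) = subst \<sigma> p * subst \<sigma> q"
proof -
  have mono: "subst \<sigma> (frag_of a * q) = eval_mono \<sigma> a * subst \<sigma> q" for a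
    using subset_UNIV
  proof (induction q rule: frag_induction)
    case (one b)
    have "frag_of a * frag_of b = frag_of (a + b)" by (simp add: mult_single)
    then show ?case by (simp only: subst_monomial eval_mono_add)
  qed (simp_all add: right_diff_distrib)
  show ?thesis
    using subset_UNIV
  proof (induction p rule: frag_induction)
    case (one a)
    then show ?case by (simp only: mono subst_monomial)
  qed (simp_all add: left_diff_distrib)
qed

lemma subst_1 [simp]: "subst \<sigma> 1 = 1"
  using subst_monomial[of \<sigma> 0] by simp

lemma subst_power [simp]: "subst \<sigma> (p ^ k) = subst \<sigma> p ^ k"
  by (induction k) simp_all

lemma subst_sum: "subst \<sigma> (\<Sum>a\<in>S. f a) = (\<Sum>a\<in>S. subst \<sigma> (f a))"
  by (induction S rule: infinite_finite_induct) simp_all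

lemma subst_prod: "subst \<sigma> (\<Prod>a\<in>S. f a) = (\<Prod>a\<in>S. subst \<sigma> (f a))"
  by (induction S rule: infinite_finite_induct) simp_all

lemma subst_pvar [simp]: "subst \<sigma> (pvar v) = \<sigma> v"
  unfolding pvar_def subst_monomial by simp

lemma subst_XY_pvar [simp]:
  "subst_XY f g (pX i) = f i" "subst_XY f g (pY i) = g i"
  by (simp_all add: subst_XY_def)

lemma subst_XY_diff [simp]: "subst_XY f g (p - q) = subst_XY f g p - subst_XY f g q"
  by (simp add: subst_XY_def)

lemma subst_lead_sum: "subst \<sigma> (lead_sum n T f w) = lead_sum n T (\<lambda>c. subst \<sigma> (f c)) w"
  unfolding lead_sum_def subst_sum subst_prod by (intro sum.cong prod.cong refl) auto

lemma subst_XY_lead_sum: "subst_XY f g (lead_sum n T h w) = lead_sum n T (\<lambda>c. subst_XY f g (h c)) w"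
  unfolding subst_XY_def by (rule subst_lead_sum)

section \<open>Top parts with respect to a single variable\<close>

definition homog :: "var \<Rightarrow> nat \<Rightarrow> pol \<Rightarrow> bool" where
  "homog v d p \<longleftrightarrow> (\<forall>m\<in>Poly_Mapping.keys p. Poly_Mapping.lookup m v = d)"

definition degree_less :: "var \<Rightarrow> nat \<Rightarrow> pol \<Rightarrow> bool" where
  "degree_less v d p \<longleftrightarrow> (\<forall>m\<in>Poly_Mapping.keys p. Poly_Mapping.lookup m v < d)"

text \<open>\<open>q\<close> may be 0, in which case \<open>d\<close> is a strict bound for the
  degree of \<open>p\<close>. Thus summands of smaller degree can be added at the same
  \<open>d\<close>.\<close>

definition top_part :: "var \<Rightarrow> nat \<Rightarrow> pol \<Rightarrow> pol \<Rightarrow> bool" where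
  "top_part v d p q \<longleftrightarrow> homog v d q \<and> degree_less v d (p - q)"

lemma homog_0 [simp]: "homog v d 0"
  by (simp add: homog_def)

lemma homog_1 [simp]: "homog v 0 1"
  by (simp add: homog_def)

lemma homog_add: "homog v d p \<Longrightarrow> homog v d q \<Longrightarrow> homog v d (p + q)"
  using keys_add[of p q] unfolding homog_def by blast

lemma homog_diff: "homog v d p \<Longrightarrow> homog v d q \<Longrightarrow> homog v d (p - q)"
  using keys_diff[of p q] unfolding homog_def by blast

lemma homog_mult:
  assumes "homog v d p" "homog v e q"
  shows "homog v (d + e) (p * q)"
  unfolding homog_def
proof
  fix m assume "m \<in> Poly_Mapping.keys (p * q)"
  then obtain a b where "m = a + b" "a \<in> Poly_Mapping.keys p" "b \<in> Poly_Mapping.keys q"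
    using keys_mult[of p q] by blast
  then show "Poly_Mapping.lookup m v = d + e"
    using assms by (simp add: homog_def lookup_add)
qed

lemma homog_pvar: "homog v (if u = v then 1 else 0) (pvar u)"
  by (simp add: homog_def pvar_def lookup_single)

lemma degree_less_0 [simp]: "degree_less v d 0"
  by (simp add: degree_less_def)

lemma degree_less_add: "degree_less v d p \<Longrightarrow> degree_less v d q \<Longrightarrow> degree_less v d (p + q)"
  using keys_add[of p q] unfolding degree_less_def by blast

lemma degree_less_mono: "degree_less v d p \<Longrightarrow> d \<le> e \<Longrightarrow> degree_less v e p"
  unfolding degree_less_def by fastforce

lemma homog_degree_less: "homog v d p \<Longrightarrow> d < e \<Longrightarrow> degree_less v e p"
  by (auto simp: homog_def degree_less_def)

lemma degree_less_mult:
  assumes "degree_less v d p" "degree_less v (Suc e) q"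
  shows "degree_less v (d + e) (p * q)"
  unfolding degree_less_def
proof
  fix m assume "m \<in> Poly_Mapping.keys (p * q)"
  then obtain a b where m: "m = a + b" "a \<in> Poly_Mapping.keys p" "b \<in> Poly_Mapping.keys q"
    using keys_mult[of p q] by blast
  then have "Poly_Mapping.lookup a v < d" "Poly_Mapping.lookup b v < Suc e"
    using assms by (simp_all add: degree_less_def)
  then show "Poly_Mapping.lookup m v < d + e"
    using m(1) by (simp add: lookup_add)
qed

lemma top_part_degree_less:
  assumes "top_part v d p q"
  shows "degree_less v (Suc d) p"
proof -
  have "degree_less v (Suc d) (p - q)" "degree_less v (Suc d) q"
    using assms by (auto simp: top_part_def intro: degree_less_mono homog_degree_less)
  then show ?thesis using degree_less_add[of v "Suc d" "p - q" q] by simp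
qed

lemma top_part_mult:
  assumes "top_part v d p q" "top_part v d' p' q'"
  shows "top_part v (d + d') (p * p') (q * q')"
proof -
  have 1: "degree_less v (d + d') ((p - q) * p')"
    using assms top_part_degree_less[OF assms(2)] by (auto simp: top_part_def intro: degree_less_mult)
  have "degree_less v (Suc d) q" using assms(1) by (auto simp: top_part_def intro: homog_degree_less)
  then have 2: "degree_less v (d' + d) ((p' - q') * q)"
    using assms by (auto simp: top_part_def intro: degree_less_mult)
  have "p * p' - q * q' = (p - q) * p' + (p' - q') * q" by (simp add: algebra_simps)
  then show ?thesis
    using 1 2 assms by (auto simp: top_part_def add.commute intro: degree_less_add homog_mult)
qed

lemma top_part_add:
  assumes "top_part v d p q" "top_part v d p' q'"
  shows "top_part v d (p + p') (q + q')"
proof -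
  have "p + p' - (q + q') = (p - q) + (p' - q')" by simp
  then show ?thesis
    using assms unfolding top_part_def by (simp only: homog_add degree_less_add simp_thms)
qed

lemma top_part_prod:
  assumes "\<And>c. c \<in> S \<Longrightarrow> top_part v (e c) (f c) (g c)"
  shows "top_part v (\<Sum>c\<in>S. e c) (\<Prod>c\<in>S. f c) (\<Prod>c\<in>S. g c)"
  using assms
  by (induction S rule: infinite_finite_induct) (auto simp: top_part_def[of v 0 1 1] intro!: top_part_mult)

lemma top_part_sum:
  assumes "\<And>c. c \<in> S \<Longrightarrow> top_part v d (f c) (g c)"
  shows "top_part v d (\<Sum>c\<in>S. f c) (\<Sum>c\<in>S. g c)"
  using assms
  by (induction S rule: infinite_finite_induct) (auto simp: top_part_def[of v d 0 0] intro!: top_part_add)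

lemma lookup_top_part:
  assumes "top_part v d p q"
  shows "Poly_Mapping.lookup m v = d \<Longrightarrow> Poly_Mapping.lookup p m = Poly_Mapping.lookup q m"
    and "m \<in> Poly_Mapping.keys q \<Longrightarrow> Poly_Mapping.lookup m v = d"
    and "m \<in> Poly_Mapping.keys p \<Longrightarrow> Poly_Mapping.lookup m v \<le> d"
proof -
  show "Poly_Mapping.lookup p m = Poly_Mapping.lookup q m" if "Poly_Mapping.lookup m v = d"
  proof -
    have "m \<notin> Poly_Mapping.keys (p - q)" using assms that by (auto simp: top_part_def degree_less_def)
    then show ?thesis by (simp add: in_keys_iff lookup_minus)
  qed
  show "m \<in> Poly_Mapping.keys q \<Longrightarrow> Poly_Mapping.lookup m v = d"
    using assms by (simp add: top_part_def homog_def)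
  show "m \<in> Poly_Mapping.keys p \<Longrightarrow> Poly_Mapping.lookup m v \<le> d"
    using top_part_degree_less[OF assms] by (auto simp: degree_less_def less_Suc_eq_le)
qed

lemma top_part_attained:
  assumes "top_part v d p q" "q \<noteq> 0"
  shows "\<exists>m\<in>Poly_Mapping.keys p. Poly_Mapping.lookup m v = d"
proof -
  obtain m where m: "m \<in> Poly_Mapping.keys q" using assms(2) by (metis keys_eq_empty ex_in_conv)
  then have "Poly_Mapping.lookup m v = d" by (rule lookup_top_part(2)[OF assms(1)])
  moreover from this have "m \<in> Poly_Mapping.keys p" using m lookup_top_part(1)[OF assms(1)] by (simp add: in_keys_iff)
  ultimately show ?thesis by blast
qed

lemma degree_in_top_part:
  assumes "top_part v d p q" "q \<noteq> 0"
  shows "degree_in v p = d"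
  unfolding degree_in_def
proof (rule Max_eqI)
  show "d \<in> insert 0 ((\<lambda>m. Poly_Mapping.lookup m v) ` Poly_Mapping.keys p)"
    using top_part_attained[OF assms] by auto
qed (use lookup_top_part(3)[OF assms(1)] in auto)

lemma leading_form_top_part:
  assumes "top_part v d p q" "q \<noteq> 0"
  shows "leading_form v p = q"
proof -
  let ?K = "{m \<in> Poly_Mapping.keys p. Poly_Mapping.lookup m v = d}"
  have K: "?K = Poly_Mapping.keys q"
  proof (rule set_eqI)
    fix m
    have "m \<in> Poly_Mapping.keys p \<longleftrightarrow> m \<in> Poly_Mapping.keys q" if "Poly_Mapping.lookup m v = d"
      unfolding in_keys_iff lookup_top_part(1)[OF assms(1) that] ..
    then show "m \<in> ?K \<longleftrightarrow> m \<in> Poly_Mapping.keys q"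
      using lookup_top_part(2)[OF assms(1)] by blast
  qed
  have "leading_form v p = (\<Sum>m\<in>Poly_Mapping.keys q. Poly_Mapping.single m (Poly_Mapping.lookup p m))"
    unfolding leading_form_def degree_in_top_part[OF assms] K ..
  also have "\<dots> = (\<Sum>m\<in>Poly_Mapping.keys q. Poly_Mapping.single m (Poly_Mapping.lookup q m))"
    using lookup_top_part(1,2)[OF assms(1)] by (intro sum.cong refl) metis
  also have "\<dots> = q"
  proof (rule poly_mapping_eqI)
    fix m
    have "Poly_Mapping.lookup (\<Sum>m\<in>Poly_Mapping.keys q. Poly_Mapping.single m (Poly_Mapping.lookup q m)) m =
        (\<Sum>a\<in>Poly_Mapping.keys q. if a = m then Poly_Mapping.lookup q a else 0)"
      unfolding lookup_sum by (intro sum.cong refl) (simp add: lookup_single when_def)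
    also have "\<dots> = Poly_Mapping.lookup q m"
      unfolding sum.delta[OF finite_keys] by (simp add: not_in_keys_iff_lookup_eq_zero)
    finally show "Poly_Mapping.lookup (\<Sum>m\<in>Poly_Mapping.keys q. Poly_Mapping.single m (Poly_Mapping.lookup q m)) m =
        Poly_Mapping.lookup q m" .
  qed
  finally show ?thesis .
qed

lemma wt_top_part:
  assumes "\<And>i j t. top_part v (if T t then 0 else 1) (tile_weight i j t) (if T t then f (i, j) else pvar v)"
  shows "top_part v (n * n - tile_count T n \<delta>) (wt n \<delta>)
    (pvar v ^ (n * n - tile_count T n \<delta>) * (\<Prod>c\<in>{1..n} \<times> {1..n}. if T (\<delta> c) then f c else 1))"
proof -
  let ?C = "{1..n} \<times> {1..n}"
  have "top_part v (\<Sum>c\<in>?C. if T (\<delta> c) then 0 else 1) (wt n \<delta>) (\<Prod>c\<in>?C. if T (\<delta> c) then f c else pvar v)"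
    unfolding wt_def
  proof (rule top_part_prod)
    fix c
    show "top_part v (if T (\<delta> c) then 0 else 1) (case c of (i, j) \<Rightarrow> tile_weight i j (\<delta> (i, j)))
        (if T (\<delta> c) then f c else pvar v)"
      using assms by (cases c) (simp only: prod.case)
  qed
  moreover have "(\<Sum>c\<in>?C. if T (\<delta> c) then 0 else 1) = n * n - tile_count T n \<delta>"
    unfolding tile_count_complement[symmetric] by (simp add: sum.If_cases Int_def)
  moreover have "(\<Prod>c\<in>?C. if T (\<delta> c) then f c else pvar v) =
      (\<Prod>c\<in>?C. (if T (\<delta> c) then 1 else pvar v) * (if T (\<delta> c) then f c else 1))"
    by (intro prod.cong) auto
  moreover have "\<dots> = pvar v ^ (n * n - tile_count T n \<delta>) * (\<Prod>c\<in>?C. if T (\<delta> c) then f c else 1)"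
    unfolding tile_count_complement[symmetric] prod.distrib by (simp add: prod.If_cases Int_def)
  ultimately show ?thesis by simp
qed

text \<open>Cancellation is excluded by \<open>\<sigma>\<close>: it sends \<open>v\<close> and each
  \<open>f c\<close> to 1, hence the expected leading form to the number of minimal pipe dreams and
  the top part of a single weight to 1.\<close>

lemma leading_form_GPD_poly:
  assumes w: "w permutes {1..n}" and b: "length_bounds n T" and ne: "min_GPDs n T w \<noteq> {}"
    and wt: "\<And>i j t. top_part v (if T t then 0 else 1) (tile_weight i j t) (if T t then f (i, j) else pvar v)"
    and \<sigma>: "\<sigma> v = 1" "\<And>c. subst \<sigma> (f c) = 1"
  shows "degree_in v (GPD_poly n w) = n\<^sup>2 - coxeter_length n w \<and>
    {\<delta> \<in> GPDs n w. contributes v (wt n \<delta>) (GPD_poly n w)} = min_GPDs n T w \<and>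
    leading_form v (GPD_poly n w) = pvar v ^ (n\<^sup>2 - coxeter_length n w) * lead_sum n T f w"
proof -
  define D where "D = n * n - coxeter_length n w"
  let ?q = "\<lambda>\<delta>. \<Prod>c\<in>{1..n} \<times> {1..n}. if T (\<delta> c) then f c else 1"
  let ?min = "\<lambda>\<delta>. tile_count T n \<delta> = coxeter_length n w"
  note top = wt_top_part[of v T f n, OF wt]
  have le: "coxeter_length n w \<le> tile_count T n \<delta>" if "\<delta> \<in> GPDs n w" for \<delta>
    using b w that by (auto simp: length_bounds_def)
  have D: "n * n - tile_count T n \<delta> = D \<longleftrightarrow> ?min \<delta>" "n * n - tile_count T n \<delta> \<le> D" if "\<delta> \<in> GPDs n w" for \<delta>
    using le[OF that] tile_count_le[of T n \<delta>] unfolding D_def by linarith+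
  have "top_part v D (wt n \<delta>) (if ?min \<delta> then pvar v ^ D * ?q \<delta> else 0)" if \<delta>: "\<delta> \<in> GPDs n w" for \<delta>
  proof (cases "?min \<delta>")
    case True
    then show ?thesis using top[of \<delta>] unfolding D_def by simp
  next
    case False
    then have "Suc (n * n - tile_count T n \<delta>) \<le> D" using D[OF \<delta>] by linarith
    then show ?thesis
      using False top_part_degree_less[OF top[of \<delta>]] by (auto simp: top_part_def intro: degree_less_mono)
  qed
  then have "top_part v D (GPD_poly n w) (\<Sum>\<delta>\<in>GPDs n w. if ?min \<delta> then pvar v ^ D * ?q \<delta> else 0)"
    unfolding GPD_poly_def by (rule top_part_sum)
  also have "(\<Sum>\<delta>\<in>GPDs n w. if ?min \<delta> then pvar v ^ D * ?q \<delta> else 0) = pvar v ^ D * lead_sum n T f w"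
    unfolding lead_sum_def min_GPDs_def sum_distrib_left by (simp only: sum.inter_filter[OF finite_GPDs])
  finally have G: "top_part v D (GPD_poly n w) (pvar v ^ D * lead_sum n T f w)" .
  have "subst \<sigma> (lead_sum n T f w) = (\<Sum>\<delta>\<in>min_GPDs n T w. 1)"
    unfolding lead_sum_def subst_sum subst_prod by (intro sum.cong refl prod.neutral) (auto simp: \<sigma>)
  then have "subst \<sigma> (pvar v ^ D * lead_sum n T f w) = of_nat (card (min_GPDs n T w))"
    by (simp add: \<sigma>)
  then have nz: "pvar v ^ D * lead_sum n T f w \<noteq> 0"
    using ne by (metis card_0_eq finite_min_GPDs of_nat_eq_0_iff subst_0)
  note deg = degree_in_top_part[OF G nz]
  have "contributes v (wt n \<delta>) (GPD_poly n w) \<longleftrightarrow> ?min \<delta>" if \<delta>: "\<delta> \<in> GPDs n w" for \<delta>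
  proof
    assume "contributes v (wt n \<delta>) (GPD_poly n w)"
    then obtain m where "m \<in> Poly_Mapping.keys (wt n \<delta>)" "Poly_Mapping.lookup m v = D"
      unfolding contributes_def deg by blast
    then have "D \<le> n * n - tile_count T n \<delta>" using lookup_top_part(3)[OF top] by blast
    then show "?min \<delta>" using D[OF \<delta>] by linarith
  next
    assume min: "?min \<delta>"
    have "subst \<sigma> (pvar v ^ D * ?q \<delta>) = (\<Prod>c\<in>{1..n} \<times> {1..n}. subst \<sigma> (if T (\<delta> c) then f c else 1))"
      by (simp add: subst_prod \<sigma>)
    also have "\<dots> = 1" by (rule prod.neutral) (auto simp: \<sigma>)
    finally have "pvar v ^ D * ?q \<delta> \<noteq> 0" by (metis subst_0 zero_neq_one)
    then show "contributes v (wt n \<delta>) (GPD_poly n w)"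
      using top_part_attained[OF top[of \<delta>]] min unfolding contributes_def deg D_def by simp
  qed
  then have "{\<delta> \<in> GPDs n w. contributes v (wt n \<delta>) (GPD_poly n w)} = min_GPDs n T w"
    by (auto simp: min_GPDs_def)
  then show ?thesis
    using deg leading_form_top_part[OF G nz] by (simp add: D_def power2_eq_square)
qed

section \<open>Double Schubert polynomials characterized by their recursion\<close>

lemma divided_difference_eqI:
  assumes "(pX i - pX (i + 1)) * q = p - subst_XY (\<lambda>k. pX (transpose i (i + 1) k)) pY p"
  shows "divided_difference i p = q"
  unfolding divided_difference_def
proof (rule the_equality)
  show "(pX i - pX (i + 1)) * q = p - subst_XY (\<lambda>k. pX (transpose i (i + 1) k)) pY p" by (rule assms)
next
  fix q' assume "(pX i - pX (i + 1)) * q' = p - subst_XY (\<lambda>k. pX (transpose i (i + 1) k)) pY p"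
  then have "(pX i - pX (i + 1)) * q' = (pX i - pX (i + 1)) * q" using assms by simp
  \<comment> \<open>The difference becomes 1 when \<open>X_var i\<close> is set to 1 and all other
    variables to 0.\<close>
  moreover have "pX i - pX (i + 1) \<noteq> 0"
  proof
    assume "pX i - pX (i + 1) = 0"
    then have "subst (\<lambda>v. if v = X_var i then 1 else 0) (pX i - pX (i + 1)) = 0" by simp
    then show False by simp
  qed
  ultimately show "q' = q" by (simp only: mult_cancel_left) blast
qed

text \<open>A permutation can be reached from the longest one along many chains of descents; the
  family \<open>P\<close> shows that all of them yield the same polynomial. Some chain exists
  because ascents can be followed upwards until none is left.\<close>

lemma double_schubert_eqI:
  assumes top: "P (longest_perm n) =
      (\<Prod>(i, j)\<in>{(i, j). i \<in> {1..n} \<and> j \<in> {1..n} \<and> i + j \<le> n}. pX i - pY j)"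
    and step: "\<And>w i. w permutes {1..n} \<Longrightarrow> 1 \<le> i \<Longrightarrow> i < n \<Longrightarrow> w (i + 1) < w i \<Longrightarrow>
      (pX i - pX (i + 1)) * P (w \<circ> transpose i (i + 1)) =
      P w - subst_XY (\<lambda>k. pX (transpose i (i + 1) k)) pY (P w)"
    and w: "w permutes {1..n}"
  shows "double_schubert n w = P w"
proof -
  have perm: "w \<circ> transpose i (i + 1) permutes {1..n}" if "w permutes {1..n}" "1 \<le> i" "i < n" for w and i :: nat
    using that by (intro permutes_compose[OF _ that(1)] permutes_swap_id) auto
  have unique: "w permutes {1..n} \<and> p = P w" if "is_double_schubert n w p" for w p
    using that
  proof (induction rule: is_double_schubert.induct)
    case top
    then show ?case using assms(1) longest_perm_permutes by simp
  next
    case (down w p i)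
    then have "divided_difference i p = P (w \<circ> transpose i (i + 1))"
      using step by (intro divided_difference_eqI) auto
    moreover have "w \<circ> transpose i (i + 1) permutes {1..n}" using perm[of w i] down by blast
    ultimately show ?case by blast
  qed
  have "\<exists>p. is_double_schubert n w p"
    using w
  proof (induction "n * n - coxeter_length n w" arbitrary: w rule: less_induct)
    case less
    show ?case
    proof (cases "\<exists>i. 1 \<le> i \<and> i < n \<and> w i < w (i + 1)")
      case True
      then obtain i where i: "1 \<le> i" "i < n" and a: "w i < w (i + 1)" by blast
      let ?u = "w \<circ> transpose i (i + 1)"
      have "n * n - coxeter_length n ?u < n * n - coxeter_length n w"
        using coxeter_length_ascent[OF less.prems i a] coxeter_length_le[of n ?u] by linarith
      then obtain p where "is_double_schubert n ?u p"
        using less.hyps[OF _ perm[OF less.prems i]] by blast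
      \<comment> \<open>An ascent of \<open>w\<close> at \<open>i\<close> is a descent of
        \<open>?u\<close> at \<open>i\<close>, so the rule \<open>down\<close> leads from
        \<open>?u\<close> back to \<open>w\<close>.\<close>
      then have "is_double_schubert n (?u \<circ> transpose i (i + 1)) (divided_difference i p)"
        using i a by (intro is_double_schubert.down) auto
      moreover have "?u \<circ> transpose i (i + 1) = w" by (simp add: comp_assoc)
      ultimately show ?thesis by auto
    next
      case False
      have "w (i + 1) < w i" if "1 \<le> i" "i < n" for i
      proof -
        have "w i \<noteq> w (i + 1)" using permutes_inj[OF less.prems] injD[of w i "i + 1"] by auto
        then show ?thesis using False that by (meson linorder_neqE_nat)
      qed
      then have "w = longest_perm n" by (rule permutation_without_ascents[OF less.prems])
      then show ?thesis using is_double_schubert.top by blast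
    qed
  qed
  then obtain p where p: "is_double_schubert n w p" ..
  then have "double_schubert n w = p"
    unfolding double_schubert_def using unique by (intro the_equality) blast+
  then show ?thesis using unique[OF p] by simp
qed

lemma double_schubert_pipe_dreams:
  assumes "1 \<le> n" "w permutes {1..n}"
  shows "double_schubert n w = lead_sum n straight (\<lambda>(i, j). pX i - pY j) w"
proof (rule double_schubert_eqI[OF _ _ assms(2)])
  show "lead_sum n straight (\<lambda>(i, j). pX i - pY j) (longest_perm n) =
      (\<Prod>(i, j)\<in>{(i, j). i \<in> {1..n} \<and> j \<in> {1..n} \<and> i + j \<le> n}. pX i - pY j)"
    by (rule lead_sum_longest_perm(1)[OF assms(1)])
next
  fix w i assume "w permutes {1..n}" "1 \<le> i" "i < n" "w (i + 1) < w i"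
  from lead_sum_straight_exchange[OF this, of pX pY]
  show "(pX i - pX (i + 1)) * lead_sum n straight (\<lambda>(i, j). pX i - pY j) (w \<circ> transpose i (i + 1)) =
      lead_sum n straight (\<lambda>(i, j). pX i - pY j) w -
      subst_XY (\<lambda>k. pX (transpose i (i + 1) k)) pY (lead_sum n straight (\<lambda>(i, j). pX i - pY j) w)"
    by (simp add: subst_XY_lead_sum case_prod_unfold)
qed

text \<open>A half turn of the grid turns the blank tiles of a bumpless pipe dream into those of the
  usual convention.\<close>

lemma double_schubert_bumpless_pipe_dreams:
  assumes "1 \<le> n" "w permutes {1..n}"
  shows "double_schubert n w =
    lead_sum n (\<lambda>t. t = Blank) (\<lambda>(i, j). pX (n + 1 - i) - pY (n + 1 - j)) (longest_perm n \<circ> w \<circ> longest_perm n)"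
proof (rule double_schubert_eqI[OF _ _ assms(2)])
  let ?f = "\<lambda>(i, j). pX (n + 1 - i) - pY (n + 1 - j)" and ?L = "longest_perm n"
  have "?L \<circ> ?L \<circ> ?L = ?L" by simp
  then have "lead_sum n (\<lambda>t. t = Blank) ?f (?L \<circ> ?L \<circ> ?L) = lead_sum n (\<lambda>t. t = Blank) ?f ?L"
    by (simp only:)
  also have "\<dots> = (\<Prod>(i, j)\<in>{(i, j). i \<in> {1..n} \<and> j \<in> {1..n} \<and> i + j \<le> n}. pX i - pY j)"
    unfolding lead_sum_longest_perm(2)[OF assms(1)] by (intro prod.cong) auto
  finally show "lead_sum n (\<lambda>t. t = Blank) ?f (?L \<circ> ?L \<circ> ?L) =
      (\<Prod>(i, j)\<in>{(i, j). i \<in> {1..n} \<and> j \<in> {1..n} \<and> i + j \<le> n}. pX i - pY j)" .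
next
  let ?f = "\<lambda>(i, j). pX (n + 1 - i) - pY (n + 1 - j)" and ?L = "longest_perm n"
  fix w i assume w: "w permutes {1..n}" and i: "1 \<le> i" "i < n" and d: "w (i + 1) < w i"
  \<comment> \<open>Conjugation by \<open>?L\<close> moves the descent of \<open>w\<close> at
    \<open>i\<close> to a descent of \<open>?v\<close> at \<open>n - i\<close>.\<close>
  define k where "k = n - i"
  have k: "1 \<le> k" "k < n" "n + 1 - k = i + 1" "n + 1 - (k + 1) = i" using i by (auto simp: k_def)
  let ?v = "?L \<circ> w \<circ> ?L"
  have "?v permutes {1..n}"
    using w longest_perm_permutes by (intro permutes_compose)
  moreover have "w i \<in> {1..n}" "w (i + 1) \<in> {1..n}" using permutes_in_image[OF w] i by auto
  then have "?v (k + 1) < ?v k" using d k by (auto simp: longest_perm_def)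
  \<comment> \<open>Blank weights in the exchange relation have the form \<open>y j - x i\<close>;
    negated and reversed variables turn them into \<open>?f\<close>.\<close>
  ultimately have "(- pX (n + 1 - k) - - pX (n + 1 - (k + 1))) *
      lead_sum n (\<lambda>t. t = Blank) (\<lambda>(i, j). - pY (n + 1 - j) - - pX (n + 1 - i)) (?v \<circ> transpose k (k + 1)) =
      lead_sum n (\<lambda>t. t = Blank) (\<lambda>(i, j). - pY (n + 1 - j) - - pX (n + 1 - i)) ?v -
      lead_sum n (\<lambda>t. t = Blank) (\<lambda>(l, j). - pY (n + 1 - j) - ((\<lambda>i. - pX (n + 1 - i)) \<circ> transpose k (k + 1)) l) ?v"
    using k by (intro lead_sum_blank_exchange)
  moreover have "?v \<circ> transpose k (k + 1) = ?L \<circ> (w \<circ> transpose i (i + 1)) \<circ> ?L"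
  proof -
    have "?L \<circ> transpose k (k + 1) = transpose i (i + 1) \<circ> ?L"
      using i k by (auto simp: fun_eq_iff longest_perm_def transpose_def)
    then show ?thesis by (simp add: comp_assoc)
  qed
  moreover have "lead_sum n (\<lambda>t. t = Blank) (\<lambda>(l, j). - pY (n + 1 - j) - ((\<lambda>i. - pX (n + 1 - i)) \<circ> transpose k (k + 1)) l) ?v =
      subst_XY (\<lambda>k. pX (transpose i (i + 1) k)) pY (lead_sum n (\<lambda>t. t = Blank) ?f ?v)"
  proof -
    have "n + 1 - transpose k (k + 1) l = transpose i (i + 1) (n + 1 - l)" if "l \<in> {1..n}" for l
      using that i by (auto simp: k_def transpose_def)
    then show ?thesis
      unfolding subst_XY_lead_sum by (intro lead_sum_cong) (auto simp: case_prod_unfold)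
  qed
  ultimately show "(pX i - pX (i + 1)) * lead_sum n (\<lambda>t. t = Blank) ?f (?L \<circ> (w \<circ> transpose i (i + 1)) \<circ> ?L) =
      lead_sum n (\<lambda>t. t = Blank) ?f ?v -
      subst_XY (\<lambda>k. pX (transpose i (i + 1) k)) pY (lead_sum n (\<lambda>t. t = Blank) ?f ?v)"
    unfolding k(3,4) by simp
qed

text \<open>Every tile weight is of one of these two shapes: free of \<open>v\<close>, or
  \<open>pvar v\<close> plus a part free of \<open>v\<close>.\<close>

lemma top_part_linear:
  assumes "u \<noteq> v" "homog v 0 p"
  shows "top_part v 0 p p" "top_part v 1 (pvar v + p) (pvar v)"
  using assms homog_pvar[of v v] by (auto simp: top_part_def intro: homog_degree_less)

theorem theorem1:
  fixes n :: nat and w :: "nat \<Rightarrow> nat"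
  assumes "n \<ge> 1" and "w permutes {1..n}"
  shows
    "(degree_in B_var (GPD_poly n w) = n\<^sup>2 - coxeter_length n w \<and>
      {\<delta> \<in> GPDs n w. contributes B_var (wt n \<delta>) (GPD_poly n w)} =
        {\<delta> \<in> GPDs n w.
           (\<forall>i\<in>{1..n}. \<forall>j\<in>{1..n}. i + j > n + 1 \<longrightarrow> \<delta> (i, j) = Blank) \<and>
           no_double_crossing n \<delta>} \<and>
      leading_form B_var (GPD_poly n w) =
        pB ^ (n\<^sup>2 - coxeter_length n w) *
        subst_XY (\<lambda>i. pA + pX i) (\<lambda>j. pY j) (double_schubert n w))
     \<and>
     (degree_in A_var (GPD_poly n w) = n\<^sup>2 - coxeter_length n w \<and>
      {\<delta> \<in> GPDs n w. contributes A_var (wt n \<delta>) (GPD_poly n w)} =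
        {\<delta> \<in> GPDs n w.
           (\<forall>i\<in>{1..n}. \<forall>j\<in>{1..n}. \<delta> (i, j) \<noteq> Bump) \<and>
           no_double_crossing n \<delta>} \<and>
      leading_form A_var (GPD_poly n w) =
        pA ^ (n\<^sup>2 - coxeter_length n w) *
        subst_XY (\<lambda>i. pB - pX (n + 1 - i)) (\<lambda>j. - pY (n + 1 - j))
          (double_schubert n (longest_perm n \<circ> w \<circ> longest_perm n)))"
proof -
  \<comment> \<open>With \<open>A = B = 1\<close> and all \<open>x\<close>, \<open>y\<close> equal
    to 0, both \<open>A + x - y\<close> and \<open>B - x + y\<close> become 1, as
    \<open>leading_form_GPD_poly\<close> requires.\<close>
  let ?L = "longest_perm n" and ?\<sigma> = "\<lambda>v. if v = A_var \<or> v = B_var then 1 else 0 :: pol"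
  have hX: "homog v 0 (pX i)" "homog v 0 (pY i)" if "v \<in> {A_var, B_var}" for i v
    using homog_pvar[of v "X_var i"] homog_pvar[of v "Y_var i"] that by auto
  have hAB: "homog B_var 0 pA" "homog A_var 0 pB"
    using homog_pvar[of B_var A_var] homog_pvar[of A_var B_var] by auto
  have wtB: "top_part B_var (if straight t then 0 else 1) (tile_weight i j t)
      (if straight t then (\<lambda>(i, j). pA + pX i - pY j) (i, j) else pB)" for i j t
    using top_part_linear(1)[of A_var B_var "pA + pX i - pY j"] top_part_linear(2)[of A_var B_var "pY j - pX i"]
      top_part_linear(2)[of A_var B_var pA] hX[of B_var] hAB
    by (cases t) (auto intro!: homog_add homog_diff simp: algebra_simps)
  have wtA: "top_part A_var (if t = Blank then 0 else 1) (tile_weight i j t)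
      (if t = Blank then (\<lambda>(i, j). pB - pX i + pY j) (i, j) else pA)" for i j t
    using top_part_linear(1)[of B_var A_var "pB - pX i + pY j"] top_part_linear(2)[of B_var A_var "pX i - pY j"]
      top_part_linear(2)[of B_var A_var pB] hX[of A_var] hAB
    by (cases t) (auto intro!: homog_add homog_diff simp: algebra_simps)
  have B: "subst_XY (\<lambda>i. pA + pX i) (\<lambda>j. pY j) (double_schubert n w) =
      lead_sum n straight (\<lambda>(i, j). pA + pX i - pY j) w"
    by (simp add: double_schubert_pipe_dreams[OF assms] subst_XY_lead_sum case_prod_unfold)
  have "?L \<circ> (?L \<circ> w \<circ> ?L) \<circ> ?L = (?L \<circ> ?L) \<circ> w \<circ> (?L \<circ> ?L)" by (simp only: comp_assoc)
  then have LL: "?L \<circ> (?L \<circ> w \<circ> ?L) \<circ> ?L = w" by simp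
  have w': "?L \<circ> w \<circ> ?L permutes {1..n}"
    using assms(2) longest_perm_permutes by (intro permutes_compose)
  \<comment> \<open>The index reversal in the substitution undoes the one in the bumpless formula.
    This holds for indices in \<open>{1..n}\<close>, which is all that \<open>lead_sum_cong\<close>
    asks for.\<close>
  have A: "subst_XY (\<lambda>i. pB - pX (n + 1 - i)) (\<lambda>j. - pY (n + 1 - j)) (double_schubert n (?L \<circ> w \<circ> ?L)) =
      lead_sum n (\<lambda>t. t = Blank) (\<lambda>(i, j). pB - pX i + pY j) w"
    unfolding double_schubert_bumpless_pipe_dreams[OF assms(1) w'] subst_XY_lead_sum LL
    by (intro lead_sum_cong) (auto simp: case_prod_unfold)
  show ?thesis
    unfolding A B min_GPDs_straight[OF assms, symmetric] min_GPDs_blank[OF assms, symmetric]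
    by (intro conjI[OF leading_form_GPD_poly[where \<sigma> = ?\<sigma>, OF assms(2) length_bounds_straight[OF assms(1)]
            min_GPDs_straight_nonempty[OF assms(2)] wtB]
          leading_form_GPD_poly[where \<sigma> = ?\<sigma>, OF assms(2) length_bounds_blank[OF assms(1)]
            min_GPDs_blank_nonempty[OF assms(2)] wtA]])
       auto
qed

end
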